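(* Let $T$ be a hyperbolic automorphism of $\mathbb T^2=\mathbb R^2/\mathbb Z^2$ given by $M_T=\begin{pmatrix} a&b\\c&d\end{pmatrix}\in GL(2,\mathbb Z)$ with $r=\operatorname{Tr}M_T>0$, $\sigma=\det M_T$. Let $m(T)$ denote the minimal possible number of preimages for an arithmetic coding of $T$. Then $m(T)$ equals the integral minimum of the associated form $f_T$, $$m(T)=\min\{|f_T(x,y)|:(x,y)\in\mathbb Z^2\setminus\{(0,0)\}\}.$$ Any minimal arithmetic coding of $T$ is naturally parametrized by a solution $(u,v)\in\mathbb Z^2$ of the equation $$f_T(u,v)=\pm m,\qquad m=m(T),$$ the coding with parameter $(u,v)$ being $\varphi_{\mathbf t}$ with $\mathbf t=\mathbf t(u,v)$.
   Context: The form associated with $T$ is $f_T(x,y)=bx^2-(a-d)xy-cy^2$. Put $D=r^2-4\sigma$, $\lambda=\frac{r+\sqrt D}2>1$. A point $x\in\mathbb T^2$ is homoclinic (to zero) if $T^nx\to0$ as $n\to\pm\infty$; it is written in coordinates of $\mathbb R^2$ as its unique lift on the $\lambda$-eigenline of $M_T$. The homoclinic points are exactly $\mathbf t(u,v)=\big(\frac{v+n\lambda}{\sqrt D},\frac{u+k\lambda}{\sqrt D}\big)$, $(u,v)\in\mathbb Z^2$, where $\binom nk=-\det M_T\cdot M_T\binom vu$. Symbolic compactum $\mathfrak X$: if $\sigma=-1$, the set of two-sided sequences with $\varepsilon_n\in\{0,\dots,r\}$ and $\varepsilon_n=r\Rightarrow\varepsilon_{n+1}=0$; if $\sigma=+1$,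 the set of two-sided sequences with $\varepsilon_n\in\{0,\dots,r-1\}$ containing no block $(r-1)(r-2)^j(r-1)$, $j\ge0$. An arithmetic coding of $T$ is a map $\varphi_{\mathbf t}:\mathfrak X\to\mathbb T^2$, $\varphi_{\mathbf t}(\varepsilon)=\lim_{N\to\infty}\big(\sum_{n=-N}^N\varepsilon_n\lambda^{-n}\big)\mathbf t\bmod\mathbb Z^2$, with $\mathbf t\neq0$ homoclinic. Each arithmetic coding is $K$-to-$1$ almost everywhere for some natural number $K$ (Lebesgue-almost every point of $\mathbb T^2$ has exactly $K$ preimages); $K$ is its number of preimages. A minimal arithmetic coding is one with the smallest possible number of preimages.
   Formalization: The coding attached to a solution (u,v) of f_T(u,v)=±m is φ_t with t=t(u,−v), not t(u,v): as written the claim fails for M_T=((1,1),(1,0)), where f_T(2,1)=1=m but the coding of t(2,1) is 5-to-1. The formula for m(T) is unchanged. *)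

theory Defs
  imports "HOL-Analysis.Analysis"
begin

section \<open>The torus \<open>\<real>\<^sup>2/\<int>\<^sup>2\<close>\<close>

definition int_congruent :: "real^2 \<Rightarrow> real^2 \<Rightarrow> bool" where
  "int_congruent x y \<longleftrightarrow> (\<forall>i. x $ i - y $ i \<in> \<int>)"

lemma equivp_int_congruent: "equivp int_congruent"
proof (rule equivpI)
  show "reflp int_congruent" by (simp add: reflp_def int_congruent_def)
  show "symp int_congruent"
    unfolding symp_def int_congruent_def by (metis Ints_minus minus_diff_eq)
  show "transp int_congruent"
    unfolding transp_def int_congruent_def
    by (metis Ints_add add_diff_eq diff_add_cancel)
qed

quotient_type torus = "real^2" / int_congruent
  morphisms rep_torus torus_of
  by (rule equivp_int_congruent)

lemma torus_of_eq_iff: "torus_of x = torus_of y \<longleftrightarrow> int_congruent x y"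
  by (fact torus.abs_eq_iff)

lemma torus_of_rep_torus: "torus_of (rep_torus p) = p"
  by (rule Quotient_abs_rep[OF Quotient_torus])

lift_definition toral_map :: "int^2^2 \<Rightarrow> torus \<Rightarrow> torus" is
  "\<lambda>M x. map_matrix real_of_int M *v x"
proof -
  fix M :: "int^2^2" and x y :: "real^2"
  assume *: "int_congruent x y"
  have "(map_matrix real_of_int M *v x) $ i - (map_matrix real_of_int M *v y) $ i
      = (\<Sum>j\<in>UNIV. of_int (M $ i $ j) * (x $ j - y $ j))" for i
    by (simp add: matrix_vector_mult_def sum_subtractf right_diff_distrib)
  moreover have "(\<Sum>j\<in>UNIV. of_int (M $ i $ j) * (x $ j - y $ j)) \<in> \<int>" for i
    by (intro Ints_sum Ints_mult Ints_of_int) (use * in \<open>simp add: int_congruent_def\<close>)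
  ultimately show "int_congruent (map_matrix real_of_int M *v x) (map_matrix real_of_int M *v y)"
    unfolding int_congruent_def by presburger
qed

text \<open>The quotient topology.\<close>

instantiation torus :: topological_space
begin

definition open_torus :: "torus set \<Rightarrow> bool" where
  "open_torus U \<longleftrightarrow> open (torus_of -` U)"

instance
proof
  fix K :: "torus set set"
  assume "\<forall>S\<in>K. open S"
  then show "open (\<Union>K)"
    by (auto simp: open_torus_def vimage_Union)
qed (auto simp: open_torus_def)

end

instance torus :: t2_space
proof
  define g :: "real^2 \<Rightarrow> complex \<times> complex"
    where "g = (\<lambda>x. (cis (2 * pi * x $ 1), cis (2 * pi * x $ 2)))"
  have cis_iff: "cis (2 * pi * s) = cis (2 * pi * t) \<longleftrightarrow> s - t \<in> \<int>" for s t :: real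
  proof
    assume "cis (2 * pi * s) = cis (2 * pi * t)"
    then have "cis (2 * pi * (s - t)) = 1"
      by (simp add: right_diff_distrib flip: cis_divide)
    then have "cos (2 * pi * (s - t)) = 1"
      by (metis cis.simps(1) one_complex.simps(1))
    then obtain n :: int where "2 * pi * (s - t) = of_int n * 2 * pi"
      unfolding cos_one_2pi_int by blast
    then have "s - t = of_int n"
      by simp
    then show "s - t \<in> \<int>" by simp
  next
    assume "s - t \<in> \<int>"
    then have "cis (2 * pi * (s - t)) = 1"
      by (rule cis_multiple_2pi)
    then have "cis (2 * pi * s) / cis (2 * pi * t) = 1"
      by (simp add: cis_divide right_diff_distrib)
    then show "cis (2 * pi * s) = cis (2 * pi * t)"
      by simp
  qed
  have g_iff: "g x = g y \<longleftrightarrow> torus_of x = torus_of y" for x y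
    by (simp add: g_def cis_iff torus_of_eq_iff int_congruent_def forall_2)
  have cont: "continuous_on UNIV g"
    unfolding g_def by (intro continuous_intros)
  have g_rep: "g (rep_torus (torus_of x)) = g x" for x
    by (simp add: g_iff torus_of_rep_torus)
  have op: "open {p. g (rep_torus p) \<in> V}" if "open V" for V
    using open_vimage[OF that cont] by (simp add: open_torus_def vimage_def g_rep)
  fix p q :: torus
  assume "p \<noteq> q"
  then have "g (rep_torus p) \<noteq> g (rep_torus q)"
    by (simp add: g_iff torus_of_rep_torus)
  from hausdorff[OF this] obtain U V where UV: "open U" "open V" "g (rep_torus p) \<in> U" "g (rep_torus q) \<in> V" "U \<inter> V = {}"
    by (elim exE conjE)
  show "\<exists>U V. open U \<and> open V \<and> p \<in> U \<and> q \<in> V \<and> U \<inter> V = {}"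
  proof (intro exI conjI)
    show "open {p. g (rep_torus p) \<in> U}" "open {p. g (rep_torus p) \<in> V}"
      by (rule op[OF UV(1)], rule op[OF UV(2)])
    show "p \<in> {p. g (rep_torus p) \<in> U}" "q \<in> {p. g (rep_torus p) \<in> V}"
      using UV(3,4) by simp_all
    show "{p. g (rep_torus p) \<in> U} \<inter> {p. g (rep_torus p) \<in> V} = {}"
      using UV(5) by blast
  qed
qed

definition torus_lebesgue :: "torus measure" where
  "torus_lebesgue =
     distr (restrict_space lborel {x :: real^2. \<forall>i. 0 \<le> x $ i \<and> x $ i < 1}) borel torus_of"

section \<open>Hyperbolic automorphisms and their homoclinic points\<close>

text \<open>\<open>invertible\<close> over \<open>\<int>\<close> is membership in \<open>GL(2,\<int>)\<close>.\<close>

definition hyperbolic :: "int^2^2 \<Rightarrow> bool" where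
  "hyperbolic M \<longleftrightarrow> invertible M \<and>
     (\<forall>(\<mu>::complex) v. v \<noteq> 0 \<and> map_matrix of_int M *v v = \<mu> *s v \<longrightarrow> cmod \<mu> \<noteq> 1)"

definition assoc_form :: "int^2^2 \<Rightarrow> int \<Rightarrow> int \<Rightarrow> int" where
  "assoc_form M x y = M$1$2 * x\<^sup>2 - (M$1$1 - M$2$2) * x * y - M$2$1 * y\<^sup>2"

definition integral_minimum :: "(int \<Rightarrow> int \<Rightarrow> int) \<Rightarrow> nat" where
  "integral_minimum f = (LEAST k. \<exists>x y. (x, y) \<noteq> (0, 0) \<and> k = nat \<bar>f x y\<bar>)"

definition discr :: "int^2^2 \<Rightarrow> int" where
  "discr M = (trace M)\<^sup>2 - 4 * det M"

definition dom_eig :: "int^2^2 \<Rightarrow> real" where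
  "dom_eig M = (of_int (trace M) + sqrt (of_int (discr M))) / 2"

definition homoclinic :: "int^2^2 \<Rightarrow> torus \<Rightarrow> bool" where
  "homoclinic M x \<longleftrightarrow>
     (\<lambda>n. (toral_map M ^^ n) x) \<longlonglongrightarrow> torus_of 0 \<and>
     (\<lambda>n. (inv (toral_map M) ^^ n) x) \<longlonglongrightarrow> torus_of 0"

text \<open>
  A homoclinic point is represented by its lift \<open>t\<close> on the eigenline of the dominant eigenvalue.
  As this line has irrational slope, the lift is unique, and \<open>t \<noteq> 0\<close> iff the point is nonzero.
\<close>

definition homoclinic_lift :: "int^2^2 \<Rightarrow> real^2 \<Rightarrow> bool" where
  "homoclinic_lift M t \<longleftrightarrow>
     homoclinic M (torus_of t) \<and> map_matrix real_of_int M *v t = dom_eig M *\<^sub>R t"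

text \<open>
  Pitfall: for \<open>w = (v, u)\<close> the determinant of the columns \<open>w, M *v w\<close> is
  \<open>- assoc_form M u (- v)\<close>, and the coding given by \<open>homoclinic_vec M u v\<close> has
  \<open>\<bar>assoc_form M u (- v)\<bar>\<close> preimages.  So the coding with \<open>\<bar>assoc_form M u v\<bar>\<close> preimages is
  the one of \<open>homoclinic_vec M u (- v)\<close>, and the sign cannot be dropped: for \<open>M\<close> with
  rows \<open>(1,1)\<close>, \<open>(1,0)\<close> we have \<open>assoc_form M 2 1 = 1\<close>, but
  \<open>homoclinic_vec M 2 1 = (mat 2 + M) *v homoclinic_vec M 1 0\<close> with \<open>det (mat 2 + M) = 5\<close>,
  so the coding of \<open>homoclinic_vec M 2 1\<close> has at least 5 preimages almost everywhere.
\<close>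

definition homoclinic_vec :: "int^2^2 \<Rightarrow> int \<Rightarrow> int \<Rightarrow> real^2" where
  "homoclinic_vec M u v =
     (let w = (- det M) *s (M *v vector [v, u]); n = w $ 1; k = w $ 2;
          lam = dom_eig M; s = sqrt (of_int (discr M))
      in vector [(of_int v + of_int n * lam) / s, (of_int u + of_int k * lam) / s])"

section \<open>Arithmetic codings\<close>

definition symb_compactum :: "int^2^2 \<Rightarrow> (int \<Rightarrow> int) set" where
  "symb_compactum M =
     (let r = trace M in
      if det M = - 1
      then {\<epsilon>. (\<forall>n. \<epsilon> n \<in> {0..r}) \<and> (\<forall>n. \<epsilon> n = r \<longrightarrow> \<epsilon> (n + 1) = 0)}
      else {\<epsilon>. (\<forall>n. \<epsilon> n \<in> {0..r - 1}) \<and>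
             \<not> (\<exists>m n. m < n \<and> \<epsilon> m = r - 1 \<and> (\<forall>i\<in>{m<..<n}. \<epsilon> i = r - 2) \<and> \<epsilon> n = r - 1)})"

definition coding :: "int^2^2 \<Rightarrow> real^2 \<Rightarrow> (int \<Rightarrow> int) \<Rightarrow> torus" where
  "coding M t = (\<lambda>\<epsilon>\<in>symb_compactum M.
     lim (\<lambda>N. torus_of ((\<Sum>n = - int N..int N. of_int (\<epsilon> n) * dom_eig M powi (- n)) *\<^sub>R t)))"

definition arithmetic_coding :: "int^2^2 \<Rightarrow> ((int \<Rightarrow> int) \<Rightarrow> torus) \<Rightarrow> bool" where
  "arithmetic_coding M \<phi> \<longleftrightarrow> (\<exists>t. t \<noteq> 0 \<and> homoclinic_lift M t \<and> \<phi> = coding M t)"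

definition to_one_ae :: "int^2^2 \<Rightarrow> ((int \<Rightarrow> int) \<Rightarrow> torus) \<Rightarrow> nat \<Rightarrow> bool" where
  "to_one_ae M \<phi> K \<longleftrightarrow>
     (AE x in torus_lebesgue. finite {\<epsilon> \<in> symb_compactum M. \<phi> \<epsilon> = x} \<and>
                              card {\<epsilon> \<in> symb_compactum M. \<phi> \<epsilon> = x} = K)"

definition min_preimages :: "int^2^2 \<Rightarrow> nat" where
  "min_preimages M = (LEAST K. \<exists>\<phi>. arithmetic_coding M \<phi> \<and> to_one_ae M \<phi> K)"

definition minimal_coding :: "int^2^2 \<Rightarrow> ((int \<Rightarrow> int) \<Rightarrow> torus) \<Rightarrow> bool" where
  "minimal_coding M \<phi> \<longleftrightarrow> arithmetic_coding M \<phi> \<and> to_one_ae M \<phi> (min_preimages M)"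

end

theory Submission
  imports Defs
begin

text \<open>
  Let \<open>\<lambda>\<close>, \<open>\<lambda>'\<close> be the eigenvalues of \<open>M\<close>, \<open>|\<lambda>'| < 1 < \<lambda>\<close>.  The homoclinic lifts are exactly the
  projections \<open>t\<close> of lattice vectors \<open>z\<close> to the \<open>\<lambda>\<close>-eigenline along the \<open>\<lambda>'\<close>-eigenline.  As
  \<open>\<lambda>\<^sup>k t\<close> and \<open>\<lambda>'\<^sup>k (t - z)\<close> agree modulo \<open>\<int>\<^sup>2\<close>, the coding of \<open>\<epsilon>\<close> is the class of \<open>x t + y (t - z)\<close>
  with \<open>x = \<Sum>\<^bsub>n\<ge>1\<^esub> \<epsilon>\<^sub>n \<lambda>\<^bsup>-n\<^esup>\<close> and \<open>y = \<Sum>\<^bsub>n\<ge>0\<^esub> \<epsilon>\<^bsub>-n\<^esub> \<lambda>'\<^bsup>n\<^esup>\<close>.  Off countably many values of \<open>x\<close> and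
  of \<open>y\<close>, the map \<open>\<epsilon> \<mapsto> (x, y)\<close> is a bijection onto an L-shaped union of two rectangles (the natural
  extension domain of the \<open>\<lambda>\<close>-expansion), and in the coordinates \<open>(x, y)\<close> this L-shape is a
  fundamental domain of the lattice spanned by \<open>z\<close> and \<open>M z\<close>.  Hence almost every point has as many
  preimages as the index \<open>|det (z, M z)|\<close> of that lattice in \<open>\<int>\<^sup>2\<close>, which is a value of the form.
\<close>

section \<open>Generic uniqueness of expansions\<close>

text \<open>In the coordinates (x, y) the vector z is (1, -1), and M z minus the trace times z is (-
  lam', lam). The notch of the L is exactly what makes its translates by these two vectors
  interlock, so the rule at the cut of a sequence matters only through the corner that it removes.
  The two determinants need separate expansions, because for determinant -1 the past is an expansion
  in a negative base; they meet again in one formula for the tile. A value has a second expansion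
  only if some tail hits an endpoint of a digit interval. Such values are countable, and each of
  them fills a line parallel to an eigenline, so the exceptional set on the torus is null. The index
  never degenerates because the discriminant is not a square. For the parametrization one more fact
  is needed: a coding determines its homoclinic point.\<close>

definition digit_sum :: "real \<Rightarrow> (nat \<Rightarrow> int) \<Rightarrow> real" where
  "digit_sum \<rho> a = (\<Sum>k. of_int (a k) * \<rho> ^ k)"

lemma summable_digits:
  fixes \<rho> :: real and a :: "nat \<Rightarrow> int"
  assumes "\<bar>\<rho>\<bar> < 1" and "\<And>k. a k \<in> {0..r}"
  shows "summable (\<lambda>k. of_int (a k) * \<rho> ^ k)"
proof (rule summable_comparison_test')
  show "summable (\<lambda>k. of_int r * \<bar>\<rho>\<bar> ^ k)"
    using assms(1) by (intro summable_mult summable_geometric) simp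
  show "norm (of_int (a k) * \<rho> ^ k) \<le> of_int r * \<bar>\<rho>\<bar> ^ k" for k
    using assms(2)[of k] by (auto simp: abs_mult power_abs intro!: mult_right_mono)
qed

lemma digit_sum_Suc:
  assumes "\<bar>\<rho>\<bar> < 1" and "\<And>k. a k \<in> {0..r}"
  shows "digit_sum \<rho> a = of_int (a 0) + \<rho> * digit_sum \<rho> (\<lambda>k. a (Suc k))"
proof -
  have "summable (\<lambda>k. of_int (a (Suc k)) * \<rho> ^ k)"
    using assms by (intro summable_digits) auto
  from suminf_mult[OF this, of \<rho>] show ?thesis
    using suminf_split_head[OF summable_digits[where a = a, OF assms]]
    by (simp add: digit_sum_def mult.left_commute)
qed

lemma digit_sum_split:
  assumes "\<bar>\<rho>\<bar> < 1" and "\<And>k. a k \<in> {0..r}"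
  shows "digit_sum \<rho> a = (\<Sum>i<n. of_int (a i) * \<rho> ^ i) + \<rho> ^ n * digit_sum \<rho> (\<lambda>k. a (n + k))"
proof (induction n)
  case (Suc n)
  show ?case
    using Suc digit_sum_Suc[of \<rho> "\<lambda>k. a (n + k)" r] assms by (simp add: algebra_simps)
qed simp

text \<open>The base may be negative, so partial sums need not increase. Bounds are supplied for
  every partial sum and come from inductions on the length that peel off the leading digit.\<close>

lemma digit_sum_le:
  assumes "\<bar>\<rho>\<bar> < 1" and "\<And>k. a k \<in> {0..r}"
    and "\<And>n. (\<Sum>i<n. of_int (a i) * \<rho> ^ i) \<le> B"
  shows "digit_sum \<rho> a \<le> B"
  unfolding digit_sum_def using summable_digits[OF assms(1,2)] assms(3) by (rule suminf_le_const)

lemma digit_sum_ge: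
  assumes "\<bar>\<rho>\<bar> < 1" and "\<And>k. a k \<in> {0..r}"
    and "\<And>n. B \<le> (\<Sum>i<n. of_int (a i) * \<rho> ^ i)"
  shows "B \<le> digit_sum \<rho> a"
  using summable_LIMSEQ[OF summable_digits[OF assms(1,2)]] assms(3)
  unfolding digit_sum_def by (meson LIMSEQ_le_const)

text \<open>The itinerary of \<open>y\<close> under an expanding map. For
  \<open>\<rho> = 1 / lam\<close> and \<open>\<delta> = floor\<close> it is the Renyi expansion in
  base \<open>lam\<close>, with the integer part as digit 0.\<close>

definition greedy_digits :: "real \<Rightarrow> (real \<Rightarrow> int) \<Rightarrow> real \<Rightarrow> nat \<Rightarrow> int" where
  "greedy_digits \<rho> \<delta> y k = \<delta> (((\<lambda>y. (y - of_int (\<delta> y)) / \<rho>) ^^ k) y)"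

text \<open>The partial sums telescope to \<open>y\<close> minus \<open>\<rho> ^ n\<close> times the
  n-th orbit point, and an orbit in a bounded set makes this error vanish.\<close>

lemma digit_sum_greedy_digits:
  assumes "\<bar>\<rho>\<bar> < 1" and "\<rho> \<noteq> 0" and "bounded J" and "y \<in> J"
    and J: "\<And>y. y \<in> J \<Longrightarrow> (y - of_int (\<delta> y)) / \<rho> \<in> J"
  shows "digit_sum \<rho> (greedy_digits \<rho> \<delta> y) = y"
proof -
  define orb where "orb k = ((\<lambda>y. (y - of_int (\<delta> y)) / \<rho>) ^^ k) y" for k
  have orb: "orb k \<in> J" for k
    by (induction k) (use assms in \<open>auto simp: orb_def\<close>)
  have orb_Suc: "of_int (greedy_digits \<rho> \<delta> y k) = orb k - \<rho> * orb (Suc k)" for k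
    using \<open>\<rho> \<noteq> 0\<close> by (simp add: orb_def greedy_digits_def)
  have part: "(\<Sum>i<n. of_int (greedy_digits \<rho> \<delta> y i) * \<rho> ^ i) = y - \<rho> ^ n * orb n" for n
    by (induction n) (simp_all add: orb_Suc algebra_simps, simp add: orb_def)
  from \<open>bounded J\<close> obtain C where C: "\<And>y. y \<in> J \<Longrightarrow> \<bar>y\<bar> \<le> C"
    by (auto simp: bounded_iff)
  have "(\<lambda>n. \<bar>\<rho>\<bar> ^ n * C) \<longlonglongrightarrow> 0"
    using assms(1) by (intro tendsto_mult_left_zero LIMSEQ_power_zero) simp
  then have "(\<lambda>n. \<rho> ^ n * orb n) \<longlonglongrightarrow> 0"
    by (rule Lim_null_comparison[rotated])
      (auto intro!: always_eventually mult_left_mono C orb simp: abs_mult power_abs)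
  then have "(\<lambda>n. y - \<rho> ^ n * orb n) \<longlonglongrightarrow> y"
    using tendsto_diff[OF tendsto_const] by fastforce
  then have "(\<lambda>k. of_int (greedy_digits \<rho> \<delta> y k) * \<rho> ^ k) sums y"
    by (simp add: sums_def part)
  then show ?thesis
    by (simp add: digit_sum_def sums_iff)
qed

lemma greedy_digits_orbit:
  assumes "y \<in> J" and "\<And>y. y \<in> J \<Longrightarrow> (y - of_int (\<delta> y)) / \<rho> \<in> J"
  obtains y' where "y' \<in> J" and "greedy_digits \<rho> \<delta> y k = \<delta> y'"
    and "\<And>j. greedy_digits \<rho> \<delta> y (k + j) = greedy_digits \<rho> \<delta> y' j"
proof
  let ?y = "((\<lambda>y. (y - of_int (\<delta> y)) / \<rho>) ^^ k) y"
  show "?y \<in> J" by (induction k) (use assms in auto)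
  show "greedy_digits \<rho> \<delta> y k = \<delta> ?y"
    by (simp add: greedy_digits_def)
  show "greedy_digits \<rho> \<delta> y (k + j) = greedy_digits \<rho> \<delta> ?y j" for j
    unfolding greedy_digits_def by (subst add.commute) (simp add: funpow_add)
qed

lemma greedy_digits_0: "greedy_digits \<rho> \<delta> y 0 = \<delta> y"
  by (simp add: greedy_digits_def)

lemma greedy_digits_Suc:
  "greedy_digits \<rho> \<delta> y (Suc k) = greedy_digits \<rho> \<delta> ((y - of_int (\<delta> y)) / \<rho>) k"
  by (simp only: greedy_digits_def funpow_Suc_right o_apply)

text \<open>Outside \<open>E\<close> the leading digit is a function of the value. \<open>N\<close>
  collects the values of a finite word followed by a tail with value in \<open>E\<close>, and there
  are only countably many words; off \<open>N\<close> every tail avoids \<open>E\<close>, so two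
  expansions of one value agree digit by digit.\<close>

lemma expansion_unique_generic:
  assumes "\<bar>\<rho>\<bar> < 1" and "\<rho> \<noteq> 0" and "countable E"
    and digits: "\<And>a k. a \<in> S \<Longrightarrow> a k \<in> {0..r}"
    and shift: "\<And>a. a \<in> S \<Longrightarrow> (\<lambda>k. a (Suc k)) \<in> S"
    and head: "\<And>a. a \<in> S \<Longrightarrow> digit_sum \<rho> a \<notin> E \<Longrightarrow> a 0 = \<delta> (digit_sum \<rho> a)"
  shows "\<exists>N. countable N \<and> E \<subseteq> N \<and>
    (\<forall>a\<in>S. \<forall>b\<in>S. digit_sum \<rho> a = digit_sum \<rho> b \<and> digit_sum \<rho> a \<notin> N \<longrightarrow> a = b)"
proof -
  define N where "N = (\<lambda>(w, e). (\<Sum>i<length w. of_int (w ! i) * \<rho> ^ i) + \<rho> ^ length w * e) `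
    ((UNIV :: int list set) \<times> E)"
  have "countable N"
    unfolding N_def using \<open>countable E\<close> by blast
  moreover have "E \<subseteq> N"
  proof
    fix e assume "e \<in> E"
    then show "e \<in> N" unfolding N_def by (intro image_eqI[of _ _ "([], e)"]) auto
  qed
  moreover have "a = b"
    if ab: "a \<in> S" "b \<in> S" "digit_sum \<rho> a = digit_sum \<rho> b" "digit_sum \<rho> a \<notin> N" for a b
  proof
    have tail: "(\<lambda>k. a (n + k)) \<in> S" if "a \<in> S" for a n
      by (induction n) (use that shift in fastforce)+
    have generic: "digit_sum \<rho> (\<lambda>k. a (n + k)) \<notin> E" if "a \<in> S" "digit_sum \<rho> a \<notin> N" for a n
    proof
      assume "digit_sum \<rho> (\<lambda>k. a (n + k)) \<in> E"
      moreover have "digit_sum \<rho> a = (\<Sum>i<length (map a [0..<n]). of_int (map a [0..<n] ! i) * \<rho> ^ i)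
          + \<rho> ^ length (map a [0..<n]) * digit_sum \<rho> (\<lambda>k. a (n + k))"
        by (subst digit_sum_split[OF assms(1) digits[OF \<open>a \<in> S\<close>], where n = n]) simp
      ultimately have "digit_sum \<rho> a \<in> N"
        unfolding N_def by (intro image_eqI[of _ _ "(map a [0..<n], digit_sum \<rho> (\<lambda>k. a (n + k)))"])
          (simp_all only: split mem_Times_iff fst_conv snd_conv UNIV_I)
      with that show False by simp
    qed
    have tails: "a n = b n"
      if "digit_sum \<rho> (\<lambda>k. a (n + k)) = digit_sum \<rho> (\<lambda>k. b (n + k))" for n
      using head[OF tail generic, OF ab(1) ab(1,4), of n] that
        head[OF tail generic, OF ab(2) ab(2), of n] ab(3,4) by (metis add_0_right)
    show "a n = b n" for n
    proof (rule tails, induction n)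
      case (Suc n)
      have "digit_sum \<rho> (\<lambda>k. w (n + k)) = of_int (w n) + \<rho> * digit_sum \<rho> (\<lambda>k. w (Suc n + k))"
        if "w \<in> S" for w
        using digit_sum_Suc[OF assms(1) digits[OF tail[OF that, where n = n]]] by simp
      from this[OF ab(1)] this[OF ab(2)] Suc tails[OF Suc] \<open>\<rho> \<noteq> 0\<close> show ?case
        by (metis add_left_cancel mult_left_cancel)
    qed (simp add: ab(3))
  qed
  ultimately show ?thesis by blast
qed

section \<open>Expansions for \<open>\<sigma> = - 1\<close>\<close>

lemma sum_digits_Suc:
  fixes \<rho> :: real
  shows "(\<Sum>i<Suc n. of_int (a i) * \<rho> ^ i) = of_int (a 0) + \<rho> * (\<Sum>i<n. of_int (a (Suc i)) * \<rho> ^ i)"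
  by (simp add: sum.lessThan_Suc_shift sum_distrib_left mult.left_commute del: sum.lessThan_Suc)

text \<open>A point of the compactum is cut between the places \<open>0\<close> and \<open>1\<close>.  The right half is read
  forwards, \<open>k \<mapsto> \<epsilon>\<^bsub>1+k\<^esub>\<close>, the left half backwards, \<open>k \<mapsto> \<epsilon>\<^bsub>-k\<^esub>\<close>.\<close>

definition neg_right :: "int \<Rightarrow> (nat \<Rightarrow> int) set" where
  "neg_right r = {a. (\<forall>k. a k \<in> {0..r}) \<and> (\<forall>k. a k = r \<longrightarrow> a (Suc k) = 0)}"

definition neg_left :: "int \<Rightarrow> (nat \<Rightarrow> int) set" where
  "neg_left r = {a. (\<forall>k. a k \<in> {0..r}) \<and> (\<forall>k. a (Suc k) = r \<longrightarrow> a k = 0)}"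

text \<open>Here \<open>lam = r + 1 / lam\<close>. A digit \<open>r\<close> is followed by 0, hence
  by a tail of value at most 1 that adds at most \<open>1 / lam\<close>; a smaller digit with its
  tail stays at or below \<open>r\<close>. So values lie in [0, lam] and the floor reads off the
  leading digit. Conversely the greedy orbit in [0, lam) obeys the rule.\<close>

lemma neg_right_expansion:
  fixes r :: int and lam :: real
  assumes "1 \<le> r" and "1 < lam" and lam2: "lam * lam = of_int r * lam + 1"
  defines "V \<equiv> digit_sum (1 / lam)"
  obtains N where "countable N"
    and "\<And>a b. a \<in> neg_right r \<Longrightarrow> b \<in> neg_right r \<Longrightarrow> V a = V b \<Longrightarrow> V a \<notin> N \<Longrightarrow> a = b"
    and "\<And>a. a \<in> neg_right r \<Longrightarrow> V a \<notin> N \<Longrightarrow> 0 \<le> V a \<and> V a < lam \<and> a 0 = \<lfloor>V a\<rfloor>"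
    and "\<And>y. 0 \<le> y \<Longrightarrow> y < lam \<Longrightarrow> \<exists>a\<in>neg_right r. V a = y \<and> a 0 = \<lfloor>y\<rfloor>"
proof -
  have \<rho>: "\<bar>1 / lam\<bar> < 1" "1 / lam \<noteq> 0" using assms by auto
  have lam_eq: "lam = of_int r + 1 / lam" using assms by (simp add: field_simps)
  have inv: "0 < 1 / lam" "1 / lam < 1" using assms by auto
  have digits: "a k \<in> {0..r}" if "a \<in> neg_right r" for a k
    using that by (simp add: neg_right_def)
  have shift: "(\<lambda>k. a (Suc k)) \<in> neg_right r" if "a \<in> neg_right r" for a
    using that by (simp add: neg_right_def)
  have partial: "(\<Sum>i<n. of_int (a i) * (1 / lam) ^ i) \<le> lam \<and>
      (a 0 = 0 \<longrightarrow> (\<Sum>i<n. of_int (a i) * (1 / lam) ^ i) \<le> 1)" if "a \<in> neg_right r" for a n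
    using that
  proof (induction n arbitrary: a)
    case 0
    then show ?case using assms by simp
  next
    case (Suc n)
    let ?S = "\<Sum>i<n. of_int (a (Suc i)) * (1 / lam) ^ i"
    have IH: "?S \<le> lam" "a (Suc 0) = 0 \<longrightarrow> ?S \<le> 1"
      using Suc.IH[OF shift[OF Suc.prems]] by auto
    have step: "1 / lam * ?S \<le> 1" "a (Suc 0) = 0 \<longrightarrow> 1 / lam * ?S \<le> 1 / lam"
      using IH assms by (auto simp: divide_le_eq intro: divide_right_mono)
    have "of_int (a 0) + 1 / lam * ?S \<le> lam"
    proof (cases "a 0 = r")
      case True
      then have "a (Suc 0) = 0" using Suc.prems by (simp add: neg_right_def)
      then show ?thesis using step lam_eq True by linarith
    next
      case False
      then have "a 0 \<le> r - 1" using digits[OF Suc.prems, of 0] by simp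
      then have "of_int (a 0) \<le> (of_int r - 1 :: real)" by linarith
      then show ?thesis using step lam_eq inv by linarith
    qed
    then show ?case unfolding sum_digits_Suc using step by auto
  qed
  have bounds: "0 \<le> V a" "V a \<le> lam" if "a \<in> neg_right r" for a
    unfolding V_def using digits[OF that] partial[OF that] assms(2)
    by (auto intro!: digit_sum_ge[OF \<rho>(1) digits[OF that]] digit_sum_le[OF \<rho>(1) digits[OF that]] sum_nonneg)
  have Suc: "V a = of_int (a 0) + 1 / lam * V (\<lambda>k. a (Suc k))" if "a \<in> neg_right r" for a
    unfolding V_def using digit_sum_Suc[OF \<rho>(1) digits[OF that]] .
  have head: "a 0 = \<lfloor>V a\<rfloor>" if "a \<in> neg_right r" "V a \<notin> \<int> \<union> {lam}" for a
  proof -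
    \<comment> \<open>The tail contributes a number in [0, 1]; excluding integers rules out 1, where
      the floor would jump past the digit.\<close>
    have "0 \<le> 1 / lam * V (\<lambda>k. a (Suc k))" "1 / lam * V (\<lambda>k. a (Suc k)) \<le> 1"
      using bounds[OF shift[OF that(1)]] assms by (auto simp: divide_le_eq)
    moreover have "V a \<noteq> of_int (a 0 + 1)" using that(2) by (metis Ints_of_int UnCI)
    ultimately show ?thesis using Suc[OF that(1)] by (intro floor_unique[symmetric]) linarith+
  qed
  have "countable (\<int> \<union> {lam})" by (simp add: Ints_def)
  then have "\<exists>N. countable N \<and> \<int> \<union> {lam} \<subseteq> N \<and>
      (\<forall>a\<in>neg_right r. \<forall>b\<in>neg_right r. V a = V b \<and> V a \<notin> N \<longrightarrow> a = b)"
    unfolding V_def by (rule expansion_unique_generic[OF \<rho>, where \<delta> = floor])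
      (fact digits shift head[unfolded V_def])+
  then obtain N where N: "countable N" "\<int> \<union> {lam} \<subseteq> N"
    "\<forall>a\<in>neg_right r. \<forall>b\<in>neg_right r. V a = V b \<and> V a \<notin> N \<longrightarrow> a = b"
    by blast
  show thesis
  proof
    show "countable N" by (rule N)
    show "a = b" if "a \<in> neg_right r" "b \<in> neg_right r" "V a = V b" "V a \<notin> N" for a b
      using N(3) that by blast
    show "0 \<le> V a \<and> V a < lam \<and> a 0 = \<lfloor>V a\<rfloor>" if "a \<in> neg_right r" "V a \<notin> N" for a
      using bounds[OF that(1)] head[OF that(1)] that(2) N(2) by force
    show "\<exists>a\<in>neg_right r. V a = y \<and> a 0 = \<lfloor>y\<rfloor>" if y: "0 \<le> y" "y < lam" for y
    proof
      let ?J = "{0..<lam}" and ?a = "greedy_digits (1 / lam) floor y"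
      have J: "(y - of_int \<lfloor>y\<rfloor>) / (1 / lam) \<in> ?J" if "y \<in> ?J" for y
        using assms mult_strict_right_mono[of "y - of_int \<lfloor>y\<rfloor>" 1 lam] by (simp add: floor_less_iff) linarith
      have dig: "\<lfloor>y\<rfloor> \<in> {0..r}" if "y \<in> ?J" for y
      proof -
        have "y < of_int r + 1" using that lam_eq inv unfolding atLeastLessThan_iff by linarith
        then show ?thesis using that by (simp add: floor_le_iff)
      qed
      have "?a k \<in> {0..r} \<and> (?a k = r \<longrightarrow> ?a (Suc k) = 0)" for k
      proof -
        have "y \<in> ?J" using y by simp
        from greedy_digits_orbit[where k = k, OF this J]
        obtain y' where y': "y' \<in> ?J" "?a k = \<lfloor>y'\<rfloor>"
          "\<And>j. ?a (k + j) = greedy_digits (1 / lam) floor y' j"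
          by blast
        have "?a (Suc k) = greedy_digits (1 / lam) floor y' (Suc 0)"
          using y'(3)[of "Suc 0"] by simp
        also have "\<dots> = \<lfloor>(y' - of_int \<lfloor>y'\<rfloor>) / (1 / lam)\<rfloor>"
          by (simp only: greedy_digits_Suc greedy_digits_0)
        finally have "?a (Suc k) = \<lfloor>(y' - of_int \<lfloor>y'\<rfloor>) / (1 / lam)\<rfloor>" .
        moreover have "(y' - of_int \<lfloor>y'\<rfloor>) / (1 / lam) < 1" if "\<lfloor>y'\<rfloor> = r"
        proof -
          have "(y' - of_int r) * lam < (lam - of_int r) * lam"
            using y'(1) assms by (intro mult_strict_right_mono) auto
          then show ?thesis using that lam2 by (simp add: algebra_simps)
        qed
        ultimately show ?thesis using J[OF y'(1)] dig[OF y'(1)] y'(2) by (auto intro: floor_unique)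
      qed
      then show "?a \<in> neg_right r" by (simp add: neg_right_def)
      have "V ?a = y"
        unfolding V_def using y by (intro digit_sum_greedy_digits[OF \<rho>, of ?J] J) auto
      then show "V ?a = y \<and> ?a 0 = \<lfloor>y\<rfloor>" by (simp add: greedy_digits_0)
    qed
  qed
qed

text \<open>A value with leading digit c is \<open>c - S / lam\<close> for a tail value S in
  [-1, lam]. If c is nonzero, the next digit is not \<open>r\<close>, so S is at most
  \<open>lam - 1\<close> and the value lies in [c - 1 + 1/lam, c + 1/lam]; only for c = 0 does the
  interval reach down to -1. These intervals cover [-1, lam], overlapping only at endpoints, and the
  one for \<open>r\<close> is [lam - 1, lam].\<close>

lemma neg_left_expansion:
  fixes r :: int and lam :: real
  assumes "1 \<le> r" and "1 < lam" and lam2: "lam * lam = of_int r * lam + 1"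
  defines "V \<equiv> digit_sum (- 1 / lam)"
  obtains N where "countable N"
    and "\<And>a b. a \<in> neg_left r \<Longrightarrow> b \<in> neg_left r \<Longrightarrow> V a = V b \<Longrightarrow> V a \<notin> N \<Longrightarrow> a = b"
    and "\<And>a. a \<in> neg_left r \<Longrightarrow> V a \<notin> N \<Longrightarrow> - 1 \<le> V a \<and> V a < lam \<and> (a 0 = r \<longleftrightarrow> lam - 1 < V a)"
    and "\<And>a. a \<in> neg_left r \<Longrightarrow> V a \<notin> N \<Longrightarrow> V a \<noteq> lam - 1"
    and "\<And>y. - 1 \<le> y \<Longrightarrow> y \<le> lam \<Longrightarrow> \<exists>a\<in>neg_left r. V a = y \<and> (a 0 = r \<longleftrightarrow> lam - 1 < y)"
proof -
  have \<rho>: "\<bar>- 1 / lam\<bar> < 1" "- 1 / lam \<noteq> 0" using assms by auto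
  have lam_eq: "lam = of_int r + 1 / lam" using assms by (simp add: field_simps)
  have inv: "0 < 1 / lam" "1 / lam < 1" using assms by auto
  have digits: "a k \<in> {0..r}" if "a \<in> neg_left r" for a k
    using that by (simp add: neg_left_def)
  have shift: "(\<lambda>k. a (Suc k)) \<in> neg_left r" if "a \<in> neg_left r" for a
    using that by (simp add: neg_left_def)
  have bracket: "of_int (a 0) - 1 + (if a 0 = 0 then 0 else 1 / lam) \<le> of_int (a 0) + - 1 / lam * S \<and>
      of_int (a 0) + - 1 / lam * S \<le> of_int (a 0) + 1 / lam"
    if "a \<in> neg_left r" "- 1 \<le> S" "S \<le> lam" "a (Suc 0) \<noteq> r \<Longrightarrow> S \<le> lam - 1" for a S
  proof -
    have "S / lam \<le> 1" "- 1 / lam \<le> S / lam"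
      using that assms(2) divide_right_mono[of "- 1" S lam] by (auto simp: divide_le_eq)
    moreover have "S / lam \<le> 1 - 1 / lam" if "a 0 \<noteq> 0"
    proof -
      have "a (Suc 0) \<noteq> r" using \<open>a \<in> neg_left r\<close> that by (auto simp: neg_left_def)
      then have "S / lam \<le> (lam - 1) / lam"
        using \<open>a (Suc 0) \<noteq> r \<Longrightarrow> S \<le> lam - 1\<close> assms by (intro divide_right_mono) auto
      then show ?thesis using assms by (simp add: diff_divide_distrib)
    qed
    ultimately show ?thesis by auto
  qed
  have bracket_bounds: "- 1 \<le> v \<and> v \<le> lam \<and> (a 0 \<noteq> r \<longrightarrow> v \<le> lam - 1)"
    if "a \<in> neg_left r" "of_int (a 0) - 1 + (if a 0 = 0 then 0 else 1 / lam) \<le> v"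
      "v \<le> of_int (a 0) + 1 / lam" for a v
  proof -
    have "0 \<le> a 0" "a 0 \<le> r" using digits[OF that(1), of 0] by auto
    then have "0 \<le> (of_int (a 0) :: real)" "of_int (a 0) \<le> (of_int r :: real)" "a 0 \<noteq> r \<longrightarrow> of_int (a 0) \<le> (of_int r - 1 :: real)"
      by auto
    moreover have "0 \<le> (if a 0 = 0 then 0 else 1 / lam)" using inv by simp
    ultimately have "- 1 \<le> v" "v \<le> lam" "a 0 \<noteq> r \<Longrightarrow> v \<le> lam - 1"
      using that(2,3) lam_eq inv by linarith+
    then show ?thesis by blast
  qed
  have partial: "- 1 \<le> (\<Sum>i<n. of_int (a i) * (- 1 / lam) ^ i) \<and>
      (\<Sum>i<n. of_int (a i) * (- 1 / lam) ^ i) \<le> lam \<and>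
      (a 0 \<noteq> r \<longrightarrow> (\<Sum>i<n. of_int (a i) * (- 1 / lam) ^ i) \<le> lam - 1)" if "a \<in> neg_left r" for a n
    using that
  proof (induction n arbitrary: a)
    case 0
    then show ?case using assms by simp
  next
    case (Suc n)
    show ?case unfolding sum_digits_Suc
      by (rule bracket_bounds[OF Suc.prems])
        (use bracket[OF Suc.prems] Suc.IH[OF shift[OF Suc.prems]] in blast)+
  qed
  have bounds: "- 1 \<le> V a" "V a \<le> lam" "a 0 \<noteq> r \<Longrightarrow> V a \<le> lam - 1" if "a \<in> neg_left r" for a
    unfolding V_def
    by ((rule digit_sum_ge[OF \<rho>(1) digits[OF that]] digit_sum_le[OF \<rho>(1) digits[OF that]],
        use partial[OF that] in blast)+)
  have V_Suc: "V a = of_int (a 0) + - 1 / lam * V (\<lambda>k. a (Suc k))" if "a \<in> neg_left r" for a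
    unfolding V_def by (rule digit_sum_Suc[OF \<rho>(1) digits[OF that]])
  have V_bracket: "of_int (a 0) - 1 + (if a 0 = 0 then 0 else 1 / lam) \<le> V a"
    "V a \<le> of_int (a 0) + 1 / lam" if "a \<in> neg_left r" for a
    unfolding V_Suc[OF that] using bracket[OF that bounds[OF shift[OF that]]] by blast+
  \<comment> \<open>The ceiling inverts the half-open versions of the digit intervals;
    \<open>max 0\<close> absorbs the longer interval of digit 0.\<close>
  define \<delta> where "\<delta> y = max 0 \<lceil>y - 1 / lam\<rceil>" for y
  define E where "E = range (\<lambda>i. of_int i + 1 / lam)"
  have head: "a 0 = \<delta> (V a)" if "a \<in> neg_left r" "V a \<notin> E" for a
  proof (cases "a 0 = 0")
    case True
    then have "\<lceil>V a - 1 / lam\<rceil> \<le> 0" using V_bracket(2)[OF that(1)] by (simp add: ceiling_le_iff)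
    then show ?thesis using True by (simp add: \<delta>_def)
  next
    case False
    have "V a \<noteq> of_int (a 0 - 1) + 1 / lam" using that(2) unfolding E_def by (metis rangeI)
    moreover have "of_int (a 0) - 1 + 1 / lam \<le> V a"
      using V_bracket(1)[OF that(1)] by (simp only: False if_False)
    ultimately have "\<lceil>V a - 1 / lam\<rceil> = a 0"
      using V_bracket(2)[OF that(1)] unfolding of_int_diff of_int_1 by (intro ceiling_unique) linarith+
    then show ?thesis using digits[OF that(1), of 0] by (simp add: \<delta>_def)
  qed
  have "lam \<in> E" unfolding E_def by (rule range_eqI[where x = r]) (rule lam_eq)
  have "lam - 1 = of_int (r - 1) + 1 / lam"
    unfolding of_int_diff of_int_1 using lam_eq by linarith
  then have "lam - 1 \<in> E" unfolding E_def by (rule range_eqI)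
  have "countable E" by (simp add: E_def)
  then have "\<exists>N. countable N \<and> E \<subseteq> N \<and>
      (\<forall>a\<in>neg_left r. \<forall>b\<in>neg_left r. V a = V b \<and> V a \<notin> N \<longrightarrow> a = b)"
    unfolding V_def by (rule expansion_unique_generic[OF \<rho>, where \<delta> = \<delta>])
      (fact digits shift head[unfolded V_def])+
  then obtain N where N: "countable N" "E \<subseteq> N"
    "\<forall>a\<in>neg_left r. \<forall>b\<in>neg_left r. V a = V b \<and> V a \<notin> N \<longrightarrow> a = b"
    by blast
  have \<delta>_r: "\<delta> y = r \<longleftrightarrow> lam - 1 < y" if "y \<le> lam" for y
  proof -
    have "\<lceil>y - 1 / lam\<rceil> \<le> r" unfolding ceiling_le_iff using that lam_eq by linarith
    moreover have "r \<le> \<lceil>y - 1 / lam\<rceil> \<longleftrightarrow> lam - 1 < y"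
      unfolding le_ceiling_iff using lam_eq by (intro iffI) linarith+
    ultimately show ?thesis using assms(1) by (auto simp: \<delta>_def)
  qed
  show thesis
  proof
    show "countable N" by (rule N)
    show "a = b" if "a \<in> neg_left r" "b \<in> neg_left r" "V a = V b" "V a \<notin> N" for a b
      using N(3) that by blast
    show "- 1 \<le> V a \<and> V a < lam \<and> (a 0 = r \<longleftrightarrow> lam - 1 < V a)" if "a \<in> neg_left r" "V a \<notin> N" for a
    proof -
      have "V a \<notin> E" using that(2) N(2) by blast
      then have "V a \<noteq> lam" "a 0 = \<delta> (V a)" using \<open>lam \<in> E\<close> head[OF that(1)] by auto
      then show ?thesis using bounds(1,2)[OF that(1)] \<delta>_r[of "V a"] by (metis order_le_less)
    qed
    show "V a \<noteq> lam - 1" if "a \<in> neg_left r" "V a \<notin> N" for a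
      using that(2) N(2) \<open>lam - 1 \<in> E\<close> by auto
    show "\<exists>a\<in>neg_left r. V a = y \<and> (a 0 = r \<longleftrightarrow> lam - 1 < y)" if y: "- 1 \<le> y" "y \<le> lam" for y
    proof
      let ?J = "{- 1..lam}" and ?a = "greedy_digits (- 1 / lam) \<delta> y"
      have div: "u / (- 1 / lam) = - u * lam" for u by simp
      \<comment> \<open>After a nonzero digit the orbit falls below \<open>lam - 1\<close>, where
        the digit \<open>r\<close> cannot occur: this is the rule for the left half.\<close>
      have low: "(y - of_int (\<delta> y)) / (- 1 / lam) < lam - 1" if "\<delta> y \<noteq> 0" for y
      proof -
        have "\<delta> y = \<lceil>y - 1 / lam\<rceil>" using that by (simp add: \<delta>_def max_def split: if_splits)
        then have "- (y - of_int (\<delta> y)) < 1 - 1 / lam"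
          using ceiling_correct[of "y - 1 / lam"] by linarith
        then have "- (y - of_int (\<delta> y)) * lam < (1 - 1 / lam) * lam"
          using assms(2) by (intro mult_strict_right_mono) auto
        also have "\<dots> = lam - 1" using assms(2) by (simp add: left_diff_distrib)
        finally show ?thesis unfolding div .
      qed
      have J: "(y - of_int (\<delta> y)) / (- 1 / lam) \<in> ?J" if "y \<in> ?J" for y
      proof -
        have "\<lceil>y - 1 / lam\<rceil> \<le> \<delta> y" by (simp add: \<delta>_def)
        then have "- (1 / lam) \<le> - (y - of_int (\<delta> y))" unfolding ceiling_le_iff by linarith
        then have "- (1 / lam) * lam \<le> - (y - of_int (\<delta> y)) * lam"
          using assms(2) by (intro mult_right_mono) auto
        then have "- 1 \<le> (y - of_int (\<delta> y)) / (- 1 / lam)"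
          unfolding div using assms(2) by simp
        moreover have "(y - of_int (\<delta> y)) / (- 1 / lam) \<le> lam"
        proof (cases "\<delta> y = 0")
          case True
          have "- y * lam \<le> 1 * lam" using that assms(2) by (intro mult_right_mono) auto
          then show ?thesis unfolding div by (simp add: True)
        next
          case False
          from low[OF this] show ?thesis by linarith
        qed
        ultimately show ?thesis by simp
      qed
      have dig: "\<delta> y \<in> {0..r}" if "y \<in> ?J" for y
      proof -
        have "\<lceil>y - 1 / lam\<rceil> \<le> r"
          unfolding ceiling_le_iff using that lam_eq unfolding atLeastAtMost_iff by linarith
        then show ?thesis using assms(1) by (simp add: \<delta>_def)
      qed
      have "?a k \<in> {0..r} \<and> (?a (Suc k) = r \<longrightarrow> ?a k = 0)" for k
      proof -
        have "y \<in> ?J" using y by simp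
        from greedy_digits_orbit[where k = k, OF this J]
        obtain y' where y': "y' \<in> ?J" "?a k = \<delta> y'"
          "\<And>j. ?a (k + j) = greedy_digits (- 1 / lam) \<delta> y' j"
          by blast
        have "?a (Suc k) = greedy_digits (- 1 / lam) \<delta> y' (Suc 0)"
          using y'(3)[of "Suc 0"] by simp
        also have "\<dots> = \<delta> ((y' - of_int (\<delta> y')) / (- 1 / lam))"
          by (simp only: greedy_digits_Suc greedy_digits_0)
        finally have "?a (Suc k) = \<delta> ((y' - of_int (\<delta> y')) / (- 1 / lam))" .
        moreover have "\<delta> ((y' - of_int (\<delta> y')) / (- 1 / lam)) \<noteq> r" if "\<delta> y' \<noteq> 0"
          using \<delta>_r[of "(y' - of_int (\<delta> y')) / (- 1 / lam)"] low[OF that] J[OF y'(1)]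
          by (metis atLeastAtMost_iff order_less_asym)
        ultimately show ?thesis using dig[OF y'(1)] y'(2) by metis
      qed
      then show "?a \<in> neg_left r" by (simp add: neg_left_def)
      have "V ?a = y"
        unfolding V_def using y by (intro digit_sum_greedy_digits[OF \<rho>, of ?J] J) auto
      then show "V ?a = y \<and> (?a 0 = r \<longleftrightarrow> lam - 1 < y)" using \<delta>_r y by (simp add: greedy_digits_0)
    qed
  qed
qed

section \<open>Expansions for \<open>\<sigma> = 1\<close>\<close>

text \<open>The excluded prefixes are those that would complete a forbidden block after a preceding
  digit \<open>r - 1\<close>.\<close>

definition no_max_prefix :: "int \<Rightarrow> (nat \<Rightarrow> int) \<Rightarrow> bool" where
  "no_max_prefix r a \<longleftrightarrow> \<not> (\<exists>n. (\<forall>i<n. a i = r - 2) \<and> a n = r - 1)"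

text \<open>The forbidden blocks are palindromes, so one set serves for the right half read forwards
  and for the left half read backwards.\<close>

definition pos_seqs :: "int \<Rightarrow> (nat \<Rightarrow> int) set" where
  "pos_seqs r = {a. (\<forall>k. a k \<in> {0..r - 1}) \<and>
     (\<forall>k. a k = r - 1 \<longrightarrow> no_max_prefix r (\<lambda>i. a (Suc k + i)))}"

lemma no_max_prefix_iff:
  "no_max_prefix r a \<longleftrightarrow> a 0 \<noteq> r - 1 \<and> (a 0 = r - 2 \<longrightarrow> no_max_prefix r (\<lambda>i. a (Suc i)))"
proof -
  have ex_nat: "(\<exists>n. P n) \<longleftrightarrow> P 0 \<or> (\<exists>n. P (Suc n))" for P :: "nat \<Rightarrow> bool"
    by (metis not0_implies_Suc)
  show ?thesis
    unfolding no_max_prefix_def by (subst ex_nat) (auto simp: All_less_Suc2)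
qed

text \<open>Here \<open>lam = r - 1 / lam\<close>. The bound \<open>lam\<close>, and the bound
  \<open>lam - 1\<close> for sequences without a maximal prefix, propagate together: a leading
  \<open>r - 1\<close> forces a tail of the second kind, which adds at most
  \<open>1 - 1 / lam\<close>. The greedy orbit mirrors this, with [0, lam - 1) as the region where
  no maximal prefix arises.\<close>

lemma pos_expansion:
  fixes r :: int and lam :: real
  assumes "3 \<le> r" and "1 < lam" and lam2: "lam * lam = of_int r * lam - 1"
  defines "V \<equiv> digit_sum (1 / lam)"
  obtains N where "countable N"
    and "\<And>a b. a \<in> pos_seqs r \<Longrightarrow> b \<in> pos_seqs r \<Longrightarrow> V a = V b \<Longrightarrow> V a \<notin> N \<Longrightarrow> a = b"
    and "\<And>a. a \<in> pos_seqs r \<Longrightarrow> V a \<notin> N \<Longrightarrow>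
      0 \<le> V a \<and> V a < lam \<and> (no_max_prefix r a \<longrightarrow> V a < lam - 1)"
    and "\<And>y. 0 \<le> y \<Longrightarrow> y < lam \<Longrightarrow>
      \<exists>a\<in>pos_seqs r. V a = y \<and> (y < lam - 1 \<longrightarrow> no_max_prefix r a)"
proof -
  have \<rho>: "\<bar>1 / lam\<bar> < 1" "1 / lam \<noteq> 0" using assms by auto
  have lam_eq: "lam = of_int r - 1 / lam" using assms by (simp add: field_simps)
  have inv: "0 < 1 / lam" "1 / lam < 1" using assms by auto
  have digits: "a k \<in> {0..r}" if "a \<in> pos_seqs r" for a k
    using that unfolding pos_seqs_def by fastforce
  have digits1: "a k \<le> r - 1" "0 \<le> a k" if "a \<in> pos_seqs r" for a k
    using that unfolding pos_seqs_def by fastforce+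
  have shift: "(\<lambda>k. a (Suc k)) \<in> pos_seqs r" if "a \<in> pos_seqs r" for a
  proof -
    have "no_max_prefix r (\<lambda>i. a (Suc (Suc k + i)))" if "a (Suc k) = r - 1" for k
      using conjunct2[OF \<open>a \<in> pos_seqs r\<close>[unfolded pos_seqs_def mem_Collect_eq], rule_format, OF that]
      by (simp only: add_Suc)
    then show ?thesis using digits1[OF that] unfolding pos_seqs_def by (simp only: mem_Collect_eq atLeastAtMost_iff) blast
  qed
  have tail: "no_max_prefix r (\<lambda>i. a (Suc i))" if "a \<in> pos_seqs r" "a 0 = r - 1" for a
    using conjunct2[OF that(1)[unfolded pos_seqs_def mem_Collect_eq], rule_format, of 0] that(2) by simp
  have partial: "(\<Sum>i<n. of_int (a i) * (1 / lam) ^ i) \<le> lam \<and>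
      (no_max_prefix r a \<longrightarrow> (\<Sum>i<n. of_int (a i) * (1 / lam) ^ i) \<le> lam - 1)"
    if "a \<in> pos_seqs r" for a n
    using that
  proof (induction n arbitrary: a)
    case 0
    then show ?case using assms by simp
  next
    case (Suc n)
    let ?S = "\<Sum>i<n. of_int (a (Suc i)) * (1 / lam) ^ i"
    have IH: "?S \<le> lam" "no_max_prefix r (\<lambda>i. a (Suc i)) \<Longrightarrow> ?S \<le> lam - 1"
      using Suc.IH[OF shift[OF Suc.prems]] by auto
    have step: "1 / lam * ?S \<le> 1" "no_max_prefix r (\<lambda>i. a (Suc i)) \<Longrightarrow> 1 / lam * ?S \<le> 1 - 1 / lam"
    proof -
      show "1 / lam * ?S \<le> 1" using IH(1) assms(2) by (simp add: divide_le_eq)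
      assume "no_max_prefix r (\<lambda>i. a (Suc i))"
      then have "1 / lam * ?S \<le> 1 / lam * (lam - 1)"
        using IH(2) assms(2) by (intro mult_left_mono) auto
      also have "\<dots> = 1 - 1 / lam" using assms(2) by (simp add: right_diff_distrib)
      finally show "1 / lam * ?S \<le> 1 - 1 / lam" .
    qed
    \<comment> \<open>\<open>i = 0\<close> yields the bound \<open>lam\<close>, and
      \<open>i = 1\<close> the bound \<open>lam - 1\<close> without a maximal prefix; the critical
      digit is \<open>r - 1 - i\<close>.\<close>
    have upper: "of_int (a 0) + 1 / lam * ?S \<le> lam - of_int i"
      if "a 0 \<le> r - 1 - i" "a 0 = r - 1 - i \<Longrightarrow> no_max_prefix r (\<lambda>i. a (Suc i))" for i
    proof (cases "a 0 = r - 1 - i")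
      case True
      then have "of_int (a 0) = (of_int r - 1 - of_int i :: real)" by simp
      then show ?thesis using step(2)[OF that(2)[OF True]] lam_eq by linarith
    next
      case False
      then have "a 0 \<le> r - 2 - i" using that(1) by simp
      then have "of_int (a 0) \<le> (of_int r - 2 - of_int i :: real)" by linarith
      then show ?thesis using step(1) lam_eq inv by linarith
    qed
    have "of_int (a 0) + 1 / lam * ?S \<le> lam"
      using upper[of 0] digits1[OF Suc.prems, of 0] tail[OF Suc.prems] by simp
    moreover have "of_int (a 0) + 1 / lam * ?S \<le> lam - 1" if "no_max_prefix r a"
      using upper[of 1] digits1[OF Suc.prems, of 0] that[unfolded no_max_prefix_iff[of r a]] by simp
    ultimately show ?case unfolding sum_digits_Suc by blast
  qed
  have bounds: "0 \<le> V a" "V a \<le> lam" "no_max_prefix r a \<Longrightarrow> V a \<le> lam - 1" if "a \<in> pos_seqs r" for a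
  proof -
    show "0 \<le> V a" unfolding V_def using digits[OF that] assms(2)
      by (auto intro!: digit_sum_ge[OF \<rho>(1) digits[OF that]] sum_nonneg)
    show "V a \<le> lam" "no_max_prefix r a \<Longrightarrow> V a \<le> lam - 1" unfolding V_def
      by ((rule digit_sum_le[OF \<rho>(1) digits[OF that]], use partial[OF that] in blast)+)
  qed
  have V_Suc: "V a = of_int (a 0) + 1 / lam * V (\<lambda>k. a (Suc k))" if "a \<in> pos_seqs r" for a
    unfolding V_def using digit_sum_Suc[OF \<rho>(1) digits[OF that]] .
  define E where "E = \<int> \<union> {lam, lam - 1}"
  have head: "a 0 = \<lfloor>V a\<rfloor>" if "a \<in> pos_seqs r" "V a \<notin> E" for a
  proof -
    have "0 \<le> 1 / lam * V (\<lambda>k. a (Suc k))" "1 / lam * V (\<lambda>k. a (Suc k)) \<le> 1"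
      using bounds[OF shift[OF that(1)]] assms by (auto simp: divide_le_eq)
    moreover have "V a \<noteq> of_int (a 0 + 1)" using that(2) unfolding E_def by (metis Ints_of_int UnCI)
    ultimately show ?thesis using V_Suc[OF that(1)] by (intro floor_unique[symmetric]) linarith+
  qed
  have "countable E" by (simp add: E_def Ints_def)
  then have "\<exists>N. countable N \<and> E \<subseteq> N \<and>
      (\<forall>a\<in>pos_seqs r. \<forall>b\<in>pos_seqs r. V a = V b \<and> V a \<notin> N \<longrightarrow> a = b)"
    unfolding V_def by (rule expansion_unique_generic[OF \<rho>, where \<delta> = floor])
      (fact digits shift head[unfolded V_def])+
  then obtain N where N: "countable N" "E \<subseteq> N"
    "\<forall>a\<in>pos_seqs r. \<forall>b\<in>pos_seqs r. V a = V b \<and> V a \<notin> N \<longrightarrow> a = b"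
    by blast
  show thesis
  proof
    show "countable N" by (rule N)
    show "a = b" if "a \<in> pos_seqs r" "b \<in> pos_seqs r" "V a = V b" "V a \<notin> N" for a b
      using N(3) that by blast
    show "0 \<le> V a \<and> V a < lam \<and> (no_max_prefix r a \<longrightarrow> V a < lam - 1)"
      if "a \<in> pos_seqs r" "V a \<notin> N" for a
    proof -
      have "V a \<noteq> lam" "V a \<noteq> lam - 1" using that(2) N(2) by (auto simp: E_def)
      then show ?thesis using bounds[OF that(1)] by (metis order_le_less)
    qed
    show "\<exists>a\<in>pos_seqs r. V a = y \<and> (y < lam - 1 \<longrightarrow> no_max_prefix r a)" if y: "0 \<le> y" "y < lam" for y
    proof
      let ?J = "{0..<lam}" and ?a = "greedy_digits (1 / lam) floor"
      have div: "u / (1 / lam) = u * lam" for u by simp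
      have J: "(y - of_int \<lfloor>y\<rfloor>) / (1 / lam) \<in> ?J" if "y \<in> ?J" for y
        using assms mult_strict_right_mono[of "y - of_int \<lfloor>y\<rfloor>" 1 lam] by (simp add: floor_less_iff) linarith
      have dig: "\<lfloor>y\<rfloor> \<in> {0..r - 1}" if "y \<in> ?J" for y
      proof -
        have "y < of_int r" using that lam_eq inv unfolding atLeastLessThan_iff by linarith
        then have "\<lfloor>y\<rfloor> < r" by (simp add: floor_less_iff)
        then show ?thesis using that by simp
      qed
      \<comment> \<open>The critical digit, \<open>r - 1\<close> below \<open>lam\<close> or
        \<open>r - 2\<close> below \<open>lam - 1\<close>, sends the orbit below
        \<open>lam - 1\<close>, where the next digit cannot be \<open>r - 1\<close>.\<close>
      have low: "(y - of_int \<lfloor>y\<rfloor>) / (1 / lam) < lam - 1" if "y < lam - of_int i" "\<lfloor>y\<rfloor> = r - 1 - i" for y i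
      proof -
        have "y - of_int \<lfloor>y\<rfloor> < 1 - 1 / lam" unfolding that(2) of_int_diff of_int_1
          using that(1) lam_eq by linarith
        then have "(y - of_int \<lfloor>y\<rfloor>) * lam < (1 - 1 / lam) * lam"
          using assms(2) by (intro mult_strict_right_mono) auto
        also have "\<dots> = lam - 1" using assms(2) by (simp add: left_diff_distrib)
        finally show ?thesis unfolding div .
      qed
      have no_max: "no_max_prefix r (?a y)" if "y \<in> ?J" "y < lam - 1" for y
      proof -
        have "\<not> ((\<forall>i<n. ?a y i = r - 2) \<and> ?a y n = r - 1)" for n
          using that
        proof (induction n arbitrary: y)
          case 0
          have "y < of_int (r - 1)" using 0 lam_eq inv unfolding of_int_diff of_int_1 by linarith
          then have "\<lfloor>y\<rfloor> < r - 1" by (simp only: floor_less_iff)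
          then show ?case by (simp add: greedy_digits_0)
        next
          case (Suc n)
          show ?case
          proof
            assume *: "(\<forall>i<Suc n. ?a y i = r - 2) \<and> ?a y (Suc n) = r - 1"
            then have "\<lfloor>y\<rfloor> = r - 1 - 1" by (metis greedy_digits_0 zero_less_Suc diff_diff_eq one_add_one)
            from low[OF _ this] Suc.prems(2)
            have "(y - of_int \<lfloor>y\<rfloor>) / (1 / lam) < lam - 1" by (simp only: of_int_1)
            from Suc.IH[OF J[OF Suc.prems(1)] this] * show False
              by (metis Suc_less_eq greedy_digits_Suc)
          qed
        qed
        then show ?thesis unfolding no_max_prefix_def by blast
      qed
      have yJ: "y \<in> ?J" using y by simp
      have "?a y k \<in> {0..r - 1} \<and> (?a y k = r - 1 \<longrightarrow> no_max_prefix r (\<lambda>i. ?a y (Suc k + i)))" for k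
      proof -
        from greedy_digits_orbit[where k = k, OF yJ J]
        obtain y' where y': "y' \<in> ?J" "?a y k = \<lfloor>y'\<rfloor>" "\<And>j. ?a y (k + j) = ?a y' j"
          by blast
        have "?a y (Suc k + i) = ?a ((y' - of_int \<lfloor>y'\<rfloor>) / (1 / lam)) i" for i
          using y'(3)[of "Suc i"] unfolding greedy_digits_Suc by simp
        then have tail_eq: "(\<lambda>i. ?a y (Suc k + i)) = ?a ((y' - of_int \<lfloor>y'\<rfloor>) / (1 / lam))"
          by (rule ext)
        have "no_max_prefix r (?a ((y' - of_int \<lfloor>y'\<rfloor>) / (1 / lam)))" if "\<lfloor>y'\<rfloor> = r - 1"
        proof (rule no_max[OF J[OF y'(1)]], rule low[where i = 0])
          show "y' < lam - of_int 0" "\<lfloor>y'\<rfloor> = r - 1 - 0" using y'(1) that by simp_all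
        qed
        then show ?thesis unfolding tail_eq y'(2) using dig[OF y'(1)] by blast
      qed
      then show "?a y \<in> pos_seqs r" unfolding pos_seqs_def mem_Collect_eq by blast
      have "V (?a y) = y"
        unfolding V_def using y by (intro digit_sum_greedy_digits[OF \<rho>, of ?J] J) auto
      then show "V (?a y) = y \<and> (y < lam - 1 \<longrightarrow> no_max_prefix r (?a y))"
        using no_max[OF yJ] by blast
    qed
  qed
qed

section \<open>The symbolic compactum\<close>

lemma all_int_split: "(\<forall>n::int. P n) \<longleftrightarrow> (\<forall>k. P (1 + int k)) \<and> (\<forall>k. P (- int k))"
proof (intro iffI allI)
  fix n :: int
  assume *: "(\<forall>k. P (1 + int k)) \<and> (\<forall>k. P (- int k))"
  show "P n"
  proof (cases "1 \<le> n")
    case True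
    then have "n = 1 + int (nat (n - 1))" by simp
    then show ?thesis using * by metis
  next
    case False
    then have "n = - int (nat (- n))" by simp
    then show ?thesis using * by metis
  qed
qed auto

definition glue :: "(nat \<Rightarrow> int) \<Rightarrow> (nat \<Rightarrow> int) \<Rightarrow> int \<Rightarrow> int" where
  "glue a b n = (if 1 \<le> n then a (nat (n - 1)) else b (nat (- n)))"

lemma glue_simps [simp]: "glue a b (1 + int k) = a k" "glue a b (- int k) = b k"
  by (simp_all add: glue_def)

lemma eq_glue: "\<epsilon> = glue (\<lambda>k. \<epsilon> (1 + int k)) (\<lambda>k. \<epsilon> (- int k))"
proof -
  have "\<forall>n. \<epsilon> n = glue (\<lambda>k. \<epsilon> (1 + int k)) (\<lambda>k. \<epsilon> (- int k)) n"
    by (subst all_int_split) simp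
  then show ?thesis by blast
qed

definition two_sided :: "int \<Rightarrow> int \<Rightarrow> (int \<Rightarrow> int) set" where
  "two_sided r \<sigma> =
     (if \<sigma> = - 1
      then {\<epsilon>. (\<forall>n. \<epsilon> n \<in> {0..r}) \<and> (\<forall>n. \<epsilon> n = r \<longrightarrow> \<epsilon> (n + 1) = 0)}
      else {\<epsilon>. (\<forall>n. \<epsilon> n \<in> {0..r - 1}) \<and>
             \<not> (\<exists>m n. m < n \<and> \<epsilon> m = r - 1 \<and> (\<forall>i\<in>{m<..<n}. \<epsilon> i = r - 2) \<and> \<epsilon> n = r - 1)})"

text \<open>The rule links neighbours only, and the one pair across the cut is \<open>b 0\<close> at
  place 0 and \<open>a 0\<close> at place 1.\<close>

lemma two_sided_neg_iff:
  "glue a b \<in> two_sided r (- 1) \<longleftrightarrow> a \<in> neg_right r \<and> b \<in> neg_left r \<and> (b 0 = r \<longrightarrow> a 0 = 0)"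
proof -
  have range: "(\<forall>n. glue a b n \<in> {0..r}) \<longleftrightarrow> (\<forall>k. a k \<in> {0..r}) \<and> (\<forall>k. b k \<in> {0..r})"
    by (subst all_int_split) (simp only: glue_simps)
  have "glue a b (1 + int k + 1) = a (Suc k)" "glue a b (- int (Suc k) + 1) = b k"
    "glue a b (- int 0 + 1) = a 0" for k
    using glue_simps(1)[of a b "Suc k"] glue_simps(2)[of a b k] glue_simps(1)[of a b 0]
    by (simp_all add: add.commute)
  then have "(\<forall>k. glue a b (1 + int k) = r \<longrightarrow> glue a b (1 + int k + 1) = 0) \<and>
    (\<forall>k. glue a b (- int k) = r \<longrightarrow> glue a b (- int k + 1) = 0) \<longleftrightarrow>
    (\<forall>k. a k = r \<longrightarrow> a (Suc k) = 0) \<and> (b 0 = r \<longrightarrow> a 0 = 0) \<and> (\<forall>k. b (Suc k) = r \<longrightarrow> b k = 0)"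
    by (metis not0_implies_Suc glue_simps)
  then have "(\<forall>n. glue a b n = r \<longrightarrow> glue a b (n + 1) = 0) \<longleftrightarrow>
    (\<forall>k. a k = r \<longrightarrow> a (Suc k) = 0) \<and> (b 0 = r \<longrightarrow> a 0 = 0) \<and> (\<forall>k. b (Suc k) = r \<longrightarrow> b k = 0)"
    unfolding all_int_split[of "\<lambda>n. glue a b n = r \<longrightarrow> glue a b (n + 1) = 0"] .
  with range show ?thesis
    unfolding two_sided_def neg_right_def neg_left_def mem_Collect_eq by auto
qed

text \<open>A forbidden block lies in one half or straddles the cut. In the latter case both halves,
  read away from the cut, begin with a maximal prefix, so two halves fit unless both have
  one.\<close>

lemma two_sided_pos_iff:
  "glue a b \<in> two_sided r 1 \<longleftrightarrow>
    a \<in> pos_seqs r \<and> b \<in> pos_seqs r \<and> (no_max_prefix r a \<or> no_max_prefix r b)"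
proof -
  let ?\<epsilon> = "glue a b"
  define block where "block m n \<longleftrightarrow>
    m < n \<and> ?\<epsilon> m = r - 1 \<and> (\<forall>i\<in>{m<..<n}. ?\<epsilon> i = r - 2) \<and> ?\<epsilon> n = r - 1" for m n
  have block_right: "block (1 + int k) (1 + int (Suc k + n)) \<longleftrightarrow>
      a k = r - 1 \<and> (\<forall>i<n. a (Suc k + i) = r - 2) \<and> a (Suc k + n) = r - 1" for k n
  proof -
    have "(\<forall>i\<in>{1 + int k<..<1 + int (Suc k + n)}. ?\<epsilon> i = r - 2) \<longleftrightarrow> (\<forall>i<n. a (Suc k + i) = r - 2)"
    proof (intro iffI ballI allI impI)
      fix i assume *: "\<forall>i\<in>{1 + int k<..<1 + int (Suc k + n)}. ?\<epsilon> i = r - 2" and "i < n"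
      then have "1 + int (Suc k + i) \<in> {1 + int k<..<1 + int (Suc k + n)}" by simp
      with * have "?\<epsilon> (1 + int (Suc k + i)) = r - 2" by blast
      then show "a (Suc k + i) = r - 2" unfolding glue_simps .
    next
      fix i assume *: "\<forall>i<n. a (Suc k + i) = r - 2" and i: "i \<in> {1 + int k<..<1 + int (Suc k + n)}"
      define j where "j = nat (i - (1 + int (Suc k)))"
      have j: "i = 1 + int (Suc k + j)" "j < n" using i by (auto simp: j_def)
      show "?\<epsilon> i = r - 2" unfolding j(1) glue_simps using * j(2) by blast
    qed
    moreover have "1 + int k < 1 + int (Suc k + n)" by simp
    ultimately show ?thesis unfolding block_def glue_simps by blast
  qed
  have block_left: "block (- int (Suc k + n)) (- int k) \<longleftrightarrow>
      b k = r - 1 \<and> (\<forall>i<n. b (Suc k + i) = r - 2) \<and> b (Suc k + n) = r - 1" for k n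
  proof -
    have "(\<forall>i\<in>{- int (Suc k + n)<..<- int k}. ?\<epsilon> i = r - 2) \<longleftrightarrow> (\<forall>i<n. b (Suc k + i) = r - 2)"
    proof (intro iffI ballI allI impI)
      fix i assume *: "\<forall>i\<in>{- int (Suc k + n)<..<- int k}. ?\<epsilon> i = r - 2" and "i < n"
      then have "- int (Suc k + i) \<in> {- int (Suc k + n)<..<- int k}" by simp
      with * have "?\<epsilon> (- int (Suc k + i)) = r - 2" by blast
      then show "b (Suc k + i) = r - 2" unfolding glue_simps .
    next
      fix i assume *: "\<forall>i<n. b (Suc k + i) = r - 2" and i: "i \<in> {- int (Suc k + n)<..<- int k}"
      define j where "j = nat (- i - int (Suc k))"
      have j: "i = - int (Suc k + j)" "j < n" using i by (auto simp: j_def)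
      show "?\<epsilon> i = r - 2" unfolding j(1) glue_simps using * j(2) by blast
    qed
    moreover have "- int (Suc k + n) < - int k" by simp
    ultimately show ?thesis unfolding block_def glue_simps by blast
  qed
  have block_mid: "block (- int m) (1 + int n) \<longleftrightarrow>
      (\<forall>i<m. b i = r - 2) \<and> b m = r - 1 \<and> (\<forall>i<n. a i = r - 2) \<and> a n = r - 1" for m n
  proof -
    have "(\<forall>i\<in>{- int m<..<1 + int n}. ?\<epsilon> i = r - 2) \<longleftrightarrow>
      (\<forall>i<m. b i = r - 2) \<and> (\<forall>i<n. a i = r - 2)"
    proof (intro iffI ballI conjI allI impI)
      fix i assume *: "\<forall>i\<in>{- int m<..<1 + int n}. ?\<epsilon> i = r - 2" and "i < m"
      then have "- int i \<in> {- int m<..<1 + int n}" by simp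
      with * have "?\<epsilon> (- int i) = r - 2" by blast
      then show "b i = r - 2" unfolding glue_simps .
    next
      fix i assume *: "\<forall>i\<in>{- int m<..<1 + int n}. ?\<epsilon> i = r - 2" and "i < n"
      then have "1 + int i \<in> {- int m<..<1 + int n}" by simp
      with * have "?\<epsilon> (1 + int i) = r - 2" by blast
      then show "a i = r - 2" unfolding glue_simps .
    next
      fix i assume *: "(\<forall>i<m. b i = r - 2) \<and> (\<forall>i<n. a i = r - 2)" and i: "i \<in> {- int m<..<1 + int n}"
      show "?\<epsilon> i = r - 2" using * i by (auto simp: glue_def)
    qed
    moreover have "- int m < 1 + int n" by simp
    ultimately show ?thesis unfolding block_def glue_simps by blast
  qed
  have no_block: "(\<nexists>m n. block m n) \<longleftrightarrow> (\<forall>k n. \<not> block (1 + int k) (1 + int (Suc k + n))) \<and>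
    (\<forall>k n. \<not> block (- int (Suc k + n)) (- int k)) \<and> (\<forall>m n. \<not> block (- int m) (1 + int n))"
    (is "_ \<longleftrightarrow> ?rhs")
  proof
    assume ?rhs
    show "\<nexists>m n. block m n"
    proof
      assume "\<exists>m n. block m n"
      then obtain m n where mn: "block m n" "m < n" unfolding block_def by blast
      consider "1 \<le> m" | "n \<le> 0" | "m \<le> 0" "1 \<le> n" by linarith
      then show False
      proof cases
        case 1
        then have "m = 1 + int (nat (m - 1))" "n = 1 + int (Suc (nat (m - 1)) + nat (n - m - 1))"
          using mn by auto
        then show False using \<open>?rhs\<close> mn by metis
      next
        case 2
        then have "n = - int (nat (- n))" "m = - int (Suc (nat (- n)) + nat (n - m - 1))"
          using mn by auto
        then show False using \<open>?rhs\<close> mn by metis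
      next
        case 3
        then have "m = - int (nat (- m))" "n = 1 + int (nat (n - 1))" by auto
        then show False using \<open>?rhs\<close> mn by metis
      qed
    qed
  qed blast
  have "(\<forall>n. ?\<epsilon> n \<in> {0..r - 1}) \<longleftrightarrow> (\<forall>k. a k \<in> {0..r - 1}) \<and> (\<forall>k. b k \<in> {0..r - 1})"
    by (subst all_int_split) (simp only: glue_simps)
  moreover have "?\<epsilon> \<in> two_sided r 1 \<longleftrightarrow> (\<forall>n. ?\<epsilon> n \<in> {0..r - 1}) \<and> (\<nexists>m n. block m n)"
    unfolding two_sided_def block_def by simp
  ultimately show ?thesis
    unfolding no_block block_right block_left block_mid pos_seqs_def no_max_prefix_def mem_Collect_eq
    by blast
qed

section \<open>The L-shaped tile as the generic image of the compactum\<close>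

locale quadratic_unit =
  fixes r \<sigma> :: int and lam :: real
  assumes \<sigma>_cases: "\<sigma> = 1 \<or> \<sigma> = - 1" and r_pos: "1 \<le> r" and r_ge_3: "\<sigma> = 1 \<Longrightarrow> 3 \<le> r"
    and lam_gt_1: "1 < lam" and lam_eq: "lam * lam = of_int r * lam - of_int \<sigma>"
begin

definition "lam' = of_int \<sigma> / lam"

definition fut :: "(int \<Rightarrow> int) \<Rightarrow> real" where
  "fut \<epsilon> = digit_sum (1 / lam) (\<lambda>k. \<epsilon> (1 + int k)) / lam"

definition past :: "(int \<Rightarrow> int) \<Rightarrow> real" where
  "past \<epsilon> = digit_sum lam' (\<lambda>k. \<epsilon> (- int k))"

definition tile_base :: real where "tile_base = (if \<sigma> = 1 then 0 else - 1)"

text \<open>The floor encodes the notch for both signs: it jumps at \<open>1 - lam'\<close> from 0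
  to 1 if \<open>\<sigma> = 1\<close>, and at \<open>- lam'\<close> from -1 to 0 if
  \<open>\<sigma> = - 1\<close>. Either way the upper limit of \<open>y\<close> drops there from
  \<open>lam\<close> to \<open>lam - 1\<close>. In this form the upper edge is a translate of lower
  edges of neighbouring copies.\<close>

definition tile :: "(real \<times> real) set" where
  "tile = {(x, y). 0 \<le> x \<and> x < 1 \<and> tile_base \<le> y \<and> y < lam + tile_base - of_int \<lfloor>x + lam'\<rfloor>}"

text \<open>The argument common to both signs: \<open>R\<close> and \<open>L\<close> are the
  admissible right and left halves, \<open>J\<close> is their compatibility at the cut. Uniqueness
  is inherited from each half separately.\<close>

lemma two_sided_fibre_aux:
  assumes X: "\<And>a b. glue a b \<in> two_sided r \<sigma> \<longleftrightarrow> a \<in> R \<and> b \<in> L \<and> J a b"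
    and uniq_R: "\<And>a b. a \<in> R \<Longrightarrow> b \<in> R \<Longrightarrow> digit_sum (1 / lam) a = digit_sum (1 / lam) b \<Longrightarrow>
      digit_sum (1 / lam) a \<notin> Nf \<Longrightarrow> a = b"
    and uniq_L: "\<And>a b. a \<in> L \<Longrightarrow> b \<in> L \<Longrightarrow> digit_sum lam' a = digit_sum lam' b \<Longrightarrow>
      digit_sum lam' a \<notin> Np \<Longrightarrow> a = b"
    and countable: "countable Nf" "countable Np"
    and sound: "\<And>a b. a \<in> R \<Longrightarrow> b \<in> L \<Longrightarrow> J a b \<Longrightarrow> digit_sum (1 / lam) a \<notin> Nf \<Longrightarrow>
      digit_sum lam' b \<notin> Np \<Longrightarrow> (digit_sum (1 / lam) a / lam, digit_sum lam' b) \<in> tile"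
    and complete: "\<And>x y. (x, y) \<in> tile \<Longrightarrow>
      \<exists>a\<in>R. \<exists>b\<in>L. J a b \<and> digit_sum (1 / lam) a = lam * x \<and> digit_sum lam' b = y"
  shows "\<exists>N1 N2. countable N1 \<and> countable N2 \<and>
    (\<forall>\<epsilon>\<in>two_sided r \<sigma>. fut \<epsilon> \<notin> N1 \<and> past \<epsilon> \<notin> N2 \<longrightarrow> (fut \<epsilon>, past \<epsilon>) \<in> tile) \<and>
    (\<forall>x y. x \<notin> N1 \<and> y \<notin> N2 \<and> (x, y) \<in> tile \<longrightarrow>
      (\<exists>!\<epsilon>. \<epsilon> \<in> two_sided r \<sigma> \<and> fut \<epsilon> = x \<and> past \<epsilon> = y))"
proof (intro exI conjI ballI allI impI)
  let ?Nf = "(\<lambda>y. y / lam) ` Nf"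
  show "countable ?Nf" "countable Np" using countable by auto
  have fut: "fut (glue a b) = digit_sum (1 / lam) a / lam" for a b by (simp add: fut_def)
  have past: "past (glue a b) = digit_sum lam' b" for a b by (simp add: past_def)
  show "(fut \<epsilon>, past \<epsilon>) \<in> tile"
    if "\<epsilon> \<in> two_sided r \<sigma>" "fut \<epsilon> \<notin> ?Nf \<and> past \<epsilon> \<notin> Np" for \<epsilon>
  proof -
    obtain a b where \<epsilon>: "\<epsilon> = glue a b" using eq_glue by blast
    show ?thesis using that unfolding \<epsilon> X fut past by (blast intro: sound)
  qed
  show "\<exists>!\<epsilon>. \<epsilon> \<in> two_sided r \<sigma> \<and> fut \<epsilon> = x \<and> past \<epsilon> = y"
    if xy: "x \<notin> ?Nf \<and> y \<notin> Np \<and> (x, y) \<in> tile" for x y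
  proof -
    obtain a b where ab: "a \<in> R" "b \<in> L" "J a b" "digit_sum (1 / lam) a = lam * x" "digit_sum lam' b = y"
      using complete xy by blast
    have N: "lam * x \<notin> Nf"
    proof
      assume "lam * x \<in> Nf"
      then have "lam * x / lam \<in> ?Nf" by blast
      then show False using xy lam_gt_1 by simp
    qed
    show ?thesis
    proof (rule ex1I[of _ "glue a b"])
      show "glue a b \<in> two_sided r \<sigma> \<and> fut (glue a b) = x \<and> past (glue a b) = y"
        unfolding X fut past using ab lam_gt_1 by simp
      fix \<epsilon> assume \<epsilon>: "\<epsilon> \<in> two_sided r \<sigma> \<and> fut \<epsilon> = x \<and> past \<epsilon> = y"
      obtain a' b' where ab': "\<epsilon> = glue a' b'" using eq_glue by blast
      have *: "a' \<in> R" "b' \<in> L" "digit_sum (1 / lam) a' = lam * x" "digit_sum lam' b' = y"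
        using \<epsilon> lam_gt_1 unfolding ab' X fut past by auto
      have "a' = a" using uniq_R[of a' a] * ab N by auto
      moreover have "b' = b" using uniq_L[of b' b] * ab xy by auto
      ultimately show "\<epsilon> = glue a b" by (simp add: ab')
    qed
  qed
qed

lemma lam'_alt: "lam' = of_int r - lam"
  using lam_eq lam_gt_1 by (simp add: lam'_def field_simps)

text \<open>Compatibility at the cut removes one corner of a rectangle. For
  \<open>\<sigma> = 1\<close> it forbids that \<open>lam * x\<close> and \<open>y\<close> both reach
  \<open>lam - 1\<close>; for \<open>\<sigma> = - 1\<close> a past above \<open>lam - 1\<close>
  starts with \<open>r\<close>, so the future starts with 0 and \<open>lam * x < 1\<close>.\<close>

lemma two_sided_fibre:
  "\<exists>N1 N2. countable N1 \<and> countable N2 \<and>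
    (\<forall>\<epsilon>\<in>two_sided r \<sigma>. fut \<epsilon> \<notin> N1 \<and> past \<epsilon> \<notin> N2 \<longrightarrow> (fut \<epsilon>, past \<epsilon>) \<in> tile) \<and>
    (\<forall>x y. x \<notin> N1 \<and> y \<notin> N2 \<and> (x, y) \<in> tile \<longrightarrow>
      (\<exists>!\<epsilon>. \<epsilon> \<in> two_sided r \<sigma> \<and> fut \<epsilon> = x \<and> past \<epsilon> = y))"
  using \<sigma>_cases
proof
  assume \<sigma>: "\<sigma> = 1"
  have lam': "lam' = 1 / lam" unfolding lam'_def by (simp add: \<sigma>)
  have eq: "lam * lam = of_int r * lam - 1" using lam_eq by (simp add: \<sigma>)
  obtain N where N: "countable N"
    "\<And>a b. a \<in> pos_seqs r \<Longrightarrow> b \<in> pos_seqs r \<Longrightarrow> digit_sum (1 / lam) a = digit_sum (1 / lam) b \<Longrightarrow>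
      digit_sum (1 / lam) a \<notin> N \<Longrightarrow> a = b"
    "\<And>a. a \<in> pos_seqs r \<Longrightarrow> digit_sum (1 / lam) a \<notin> N \<Longrightarrow> 0 \<le> digit_sum (1 / lam) a \<and>
      digit_sum (1 / lam) a < lam \<and> (no_max_prefix r a \<longrightarrow> digit_sum (1 / lam) a < lam - 1)"
    "\<And>y. 0 \<le> y \<Longrightarrow> y < lam \<Longrightarrow>
      \<exists>a\<in>pos_seqs r. digit_sum (1 / lam) a = y \<and> (y < lam - 1 \<longrightarrow> no_max_prefix r a)"
    by (rule pos_expansion[OF r_ge_3[OF \<sigma>] lam_gt_1 eq])
      (rule that; assumption)
  have lam'_bounds: "0 < lam'" "lam' < 1" using lam_gt_1 by (simp_all add: lam')
  have tile_iff: "(x, y) \<in> tile \<longleftrightarrow>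
      0 \<le> lam * x \<and> lam * x < lam \<and> 0 \<le> y \<and> y < lam \<and> (lam * x < lam - 1 \<or> y < lam - 1)" for x y
  proof -
    have x: "0 \<le> lam * x \<longleftrightarrow> 0 \<le> x" "lam * x < lam \<longleftrightarrow> x < 1"
      using lam_gt_1 by (auto simp: zero_le_mult_iff)
    have "lam * x < lam - 1 \<longleftrightarrow> x < 1 - lam'"
      using lam_gt_1 by (simp add: lam' field_simps)
    moreover have "\<lfloor>x + lam'\<rfloor> = (if x < 1 - lam' then 0 else 1)" if "0 \<le> x" "x < 1"
      using that lam'_bounds by (auto intro!: floor_unique)
    ultimately show ?thesis
      unfolding tile_def mem_Collect_eq split x tile_base_def if_P[OF \<sigma>] by auto
  qed
  have mul: "lam * (u / lam) = u" for u using lam_gt_1 by simp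
  show ?thesis
  proof (rule two_sided_fibre_aux[where R = "pos_seqs r" and L = "pos_seqs r"
        and J = "\<lambda>a b. no_max_prefix r a \<or> no_max_prefix r b" and Nf = N and Np = N])
    show "glue a b \<in> two_sided r \<sigma> \<longleftrightarrow>
      a \<in> pos_seqs r \<and> b \<in> pos_seqs r \<and> (no_max_prefix r a \<or> no_max_prefix r b)" for a b
      unfolding \<sigma> by (rule two_sided_pos_iff)
    show "(digit_sum (1 / lam) a / lam, digit_sum lam' b) \<in> tile"
      if "a \<in> pos_seqs r" "b \<in> pos_seqs r" "no_max_prefix r a \<or> no_max_prefix r b"
        "digit_sum (1 / lam) a \<notin> N" "digit_sum lam' b \<notin> N" for a b
      using N(3)[of a] N(3)[of b] that unfolding tile_iff mul lam' by blast
    show "\<exists>a\<in>pos_seqs r. \<exists>b\<in>pos_seqs r. (no_max_prefix r a \<or> no_max_prefix r b) \<and>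
      digit_sum (1 / lam) a = lam * x \<and> digit_sum lam' b = y" if "(x, y) \<in> tile" for x y
    proof -
      have *: "0 \<le> lam * x" "lam * x < lam" "0 \<le> y" "y < lam" "lam * x < lam - 1 \<or> y < lam - 1"
        using that unfolding tile_iff by auto
      from N(4)[OF *(1,2)] N(4)[OF *(3,4)] *(5) show ?thesis unfolding lam' by blast
    qed
  qed (unfold lam', (use N in blast)+)
next
  assume \<sigma>: "\<sigma> = - 1"
  have lam': "lam' = - 1 / lam" unfolding lam'_def by (simp add: \<sigma>)
  have eq: "lam * lam = of_int r * lam + 1" using lam_eq by (simp add: \<sigma>)
  obtain N where N: "countable N"
    "\<And>a b. a \<in> neg_right r \<Longrightarrow> b \<in> neg_right r \<Longrightarrow>
      digit_sum (1 / lam) a = digit_sum (1 / lam) b \<Longrightarrow> digit_sum (1 / lam) a \<notin> N \<Longrightarrow> a = b"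
    "\<And>a. a \<in> neg_right r \<Longrightarrow> digit_sum (1 / lam) a \<notin> N \<Longrightarrow> 0 \<le> digit_sum (1 / lam) a \<and>
      digit_sum (1 / lam) a < lam \<and> a 0 = \<lfloor>digit_sum (1 / lam) a\<rfloor>"
    "\<And>y. 0 \<le> y \<Longrightarrow> y < lam \<Longrightarrow> \<exists>a\<in>neg_right r. digit_sum (1 / lam) a = y \<and> a 0 = \<lfloor>y\<rfloor>"
    by (rule neg_right_expansion[OF r_pos lam_gt_1 eq])
      (rule that; assumption)
  obtain N' where N': "countable N'"
    "\<And>a b. a \<in> neg_left r \<Longrightarrow> b \<in> neg_left r \<Longrightarrow> digit_sum (- 1 / lam) a = digit_sum (- 1 / lam) b \<Longrightarrow>
      digit_sum (- 1 / lam) a \<notin> N' \<Longrightarrow> a = b"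
    "\<And>a. a \<in> neg_left r \<Longrightarrow> digit_sum (- 1 / lam) a \<notin> N' \<Longrightarrow> - 1 \<le> digit_sum (- 1 / lam) a \<and>
      digit_sum (- 1 / lam) a < lam \<and> (a 0 = r \<longleftrightarrow> lam - 1 < digit_sum (- 1 / lam) a)"
    "\<And>a. a \<in> neg_left r \<Longrightarrow> digit_sum (- 1 / lam) a \<notin> N' \<Longrightarrow> digit_sum (- 1 / lam) a \<noteq> lam - 1"
    "\<And>y. - 1 \<le> y \<Longrightarrow> y \<le> lam \<Longrightarrow>
      \<exists>a\<in>neg_left r. digit_sum (- 1 / lam) a = y \<and> (a 0 = r \<longleftrightarrow> lam - 1 < y)"
    by (rule neg_left_expansion[OF r_pos lam_gt_1 eq])
      (rule that; assumption)
  have lam'_bounds: "- 1 < lam'" "lam' < 0" using lam_gt_1 by (simp_all add: lam')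
  have tile_iff: "(x, y) \<in> tile \<longleftrightarrow>
      0 \<le> lam * x \<and> lam * x < lam \<and> - 1 \<le> y \<and> y < lam \<and> (lam * x < 1 \<or> y < lam - 1)" for x y
  proof -
    have x: "0 \<le> lam * x \<longleftrightarrow> 0 \<le> x" "lam * x < lam \<longleftrightarrow> x < 1"
      using lam_gt_1 by (auto simp: zero_le_mult_iff)
    have "lam * x < 1 \<longleftrightarrow> x < - lam'"
      using lam_gt_1 by (simp add: lam' field_simps)
    moreover have "\<lfloor>x + lam'\<rfloor> = (if x < - lam' then - 1 else 0)" if "0 \<le> x" "x < 1"
      using that lam'_bounds by (auto intro!: floor_unique)
    moreover have "tile_base = - 1" unfolding tile_base_def by (simp add: \<sigma>)
    ultimately show ?thesis
      unfolding tile_def mem_Collect_eq split x by auto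
  qed
  have mul: "lam * (u / lam) = u" for u using lam_gt_1 by simp
  show ?thesis
  proof (rule two_sided_fibre_aux[where R = "neg_right r" and L = "neg_left r"
        and J = "\<lambda>a b. b 0 = r \<longrightarrow> a 0 = 0" and Nf = N and Np = N'])
    show "glue a b \<in> two_sided r \<sigma> \<longleftrightarrow>
      a \<in> neg_right r \<and> b \<in> neg_left r \<and> (b 0 = r \<longrightarrow> a 0 = 0)" for a b
      unfolding \<sigma> by (rule two_sided_neg_iff)
    show "(digit_sum (1 / lam) a / lam, digit_sum lam' b) \<in> tile"
      if ab: "a \<in> neg_right r" "b \<in> neg_left r" "b 0 = r \<longrightarrow> a 0 = 0"
        "digit_sum (1 / lam) a \<notin> N" "digit_sum lam' b \<notin> N'" for a b
    proof -
      have "digit_sum (1 / lam) a < 1" if "a 0 = 0"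
        using N(3)[OF ab(1,4)] that by linarith
      then show ?thesis
        unfolding tile_iff mul using N(3)[OF ab(1,4)] N'(3,4)[OF ab(2) ab(5)[unfolded lam']] ab(3)
        unfolding lam' by (metis linorder_neqE)
    qed
    show "\<exists>a\<in>neg_right r. \<exists>b\<in>neg_left r. (b 0 = r \<longrightarrow> a 0 = 0) \<and>
      digit_sum (1 / lam) a = lam * x \<and> digit_sum lam' b = y" if xy: "(x, y) \<in> tile" for x y
    proof -
      have *: "0 \<le> lam * x" "lam * x < lam" "- 1 \<le> y" "y \<le> lam" "lam * x < 1 \<or> y < lam - 1"
        using xy unfolding tile_iff by auto
      obtain a where a: "a \<in> neg_right r" "digit_sum (1 / lam) a = lam * x" "a 0 = \<lfloor>lam * x\<rfloor>"
        using N(4)[OF *(1,2)] by blast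
      obtain b where b: "b \<in> neg_left r" "digit_sum lam' b = y" "b 0 = r \<longleftrightarrow> lam - 1 < y"
        unfolding lam' using N'(5)[OF *(3,4)] by blast
      have "a 0 = 0" if "lam * x < 1" unfolding a(3) using *(1) that by (intro floor_unique) auto
      then have "b 0 = r \<longrightarrow> a 0 = 0" using *(5) b(3) by auto
      then show ?thesis using a b by blast
    qed
  qed (unfold lam', (use N N' in blast)+)
qed

end

section \<open>Tilings and sublattices\<close>

text \<open>Steps of at least \<open>d\<close> make \<open>h\<close> increasing and unbounded on
  both sides, so its half-open brackets partition the line.\<close>

lemma bracket_unique:
  fixes h :: "int \<Rightarrow> real"
  assumes step: "\<And>j. h j + d \<le> h (j + 1)" and "0 < d"
  shows "\<exists>!j. h j \<le> y \<and> y < h (j + 1)"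
proof -
  have grow: "h k + of_nat n * d \<le> h (k + int n)" for k n
  proof (induction n)
    case (Suc n)
    then show ?case using step[of "k + int n"] by (simp add: algebra_simps)
  qed simp
  have mono: "h i \<le> h j" if "i \<le> j" for i j
  proof -
    have "h (i + int (nat (j - i))) = h j" using that by simp
    moreover have "0 \<le> of_nat (nat (j - i)) * d" using \<open>0 < d\<close> by simp
    ultimately show ?thesis using grow[of i "nat (j - i)"] by linarith
  qed
  obtain n1 :: nat where "h 0 - y < of_nat n1 * d"
    using \<open>0 < d\<close> reals_Archimedean3 by blast
  then have n1: "h (- int n1) \<le> y" using grow[of "- int n1" n1] by simp
  obtain n2 :: nat where "y - h (- int n1) < of_nat n2 * d"
    using \<open>0 < d\<close> reals_Archimedean3 by blast
  then have n2: "y < h (- int n1 + int n2)" using grow[of "- int n1" n2] by simp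
  define m where "m = (LEAST m. y < h (- int n1 + int m))"
  have m: "y < h (- int n1 + int m)" unfolding m_def using n2 by (rule LeastI)
  then obtain m' where m': "m = Suc m'" using n1 by (cases m) auto
  have "\<not> y < h (- int n1 + int m')"
    using not_less_Least[of m' "\<lambda>m. y < h (- int n1 + int m)"] m' unfolding m_def by auto
  then have "h (- int n1 + int m') \<le> y \<and> y < h (- int n1 + int m' + 1)"
    using m by (simp add: m' algebra_simps)
  then show ?thesis
  proof (rule ex1I)
    fix j assume j: "h j \<le> y \<and> y < h (j + 1)"
    have "\<not> j + 1 \<le> - int n1 + int m'" "\<not> - int n1 + int m' + 1 \<le> j"
      using mono[of "j + 1" "- int n1 + int m'"] mono[of "- int n1 + int m' + 1" j] j
        \<open>h (- int n1 + int m') \<le> y \<and> y < h (- int n1 + int m' + 1)\<close> by linarith+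
    then show "j = - int n1 + int m'" by linarith
  qed
qed

context quadratic_unit
begin

lemma abs_lam': "\<bar>lam'\<bar> < 1"
  using \<sigma>_cases lam_gt_1 by (auto simp: lam'_def)

text \<open>The translates of the tile by multiples of \<open>(1, - 1)\<close> fill the strip between the graph of
  \<open>x \<mapsto> tile_base - \<lfloor>x\<rfloor>\<close> and its translate by \<open>(- lam', lam)\<close>.\<close>

lemma tile_translates:
  "\<exists>!ij. (x - of_int (fst ij) + of_int (snd ij) * lam', y + of_int (fst ij) - of_int (snd ij) * lam) \<in> tile"
proof -
  \<comment> \<open>The lower edge, above \<open>x\<close>, of the j-th layer. As
    \<open>|lam'| < 1\<close>, the floor rises by at most 1 per step, so \<open>h\<close> grows by
    at least \<open>lam - 1 > 0\<close>.\<close>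
  define h where "h j = of_int j * lam - of_int \<lfloor>x + of_int j * lam'\<rfloor> + tile_base" for j :: int
  have "h j + (lam - 1) \<le> h (j + 1)" for j
  proof -
    have "\<lfloor>x + of_int (j + 1) * lam'\<rfloor> \<le> \<lfloor>x + of_int j * lam'\<rfloor> + 1"
      unfolding floor_le_iff using abs_lam' floor_correct[of "x + of_int j * lam'"]
      by (simp add: distrib_right) linarith
    then have "(of_int \<lfloor>x + of_int (j + 1) * lam'\<rfloor> :: real) \<le> of_int \<lfloor>x + of_int j * lam'\<rfloor> + 1"
      by linarith
    then show ?thesis unfolding h_def by (simp add: distrib_right)
  qed
  then have ex1: "\<exists>!j. h j \<le> y \<and> y < h (j + 1)"
    by (rule bracket_unique) (use lam_gt_1 in simp)
  \<comment> \<open>Membership decouples: the range of the first coordinate fixes \<open>i\<close>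
    as a floor, and then the range of the second is the bracket from \<open>h j\<close> to
    \<open>h (j + 1)\<close>.\<close>
  have iff: "(x - of_int i + of_int j * lam', y + of_int i - of_int j * lam) \<in> tile \<longleftrightarrow>
      i = \<lfloor>x + of_int j * lam'\<rfloor> \<and> h j \<le> y \<and> y < h (j + 1)" for i j
  proof -
    have 1: "0 \<le> x - of_int i + of_int j * lam' \<and> x - of_int i + of_int j * lam' < 1 \<longleftrightarrow>
      i = \<lfloor>x + of_int j * lam'\<rfloor>"
      using floor_eq_iff[of "x + of_int j * lam'" i] by (auto simp: algebra_simps)
    have "x - of_int i + of_int j * lam' + lam' = x + of_int (j + 1) * lam' - of_int i"
      by (simp add: algebra_simps)
    then have 2: "\<lfloor>x - of_int i + of_int j * lam' + lam'\<rfloor> = \<lfloor>x + of_int (j + 1) * lam'\<rfloor> - i"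
      by (simp only: floor_diff_of_int)
    show ?thesis
      unfolding tile_def mem_Collect_eq split 2 h_def conj_assoc[symmetric] 1
      unfolding conj_assoc by (intro conj_cong refl) (auto simp: algebra_simps)
  qed
  from ex1 obtain j where j: "h j \<le> y \<and> y < h (j + 1)" "\<And>j'. h j' \<le> y \<and> y < h (j' + 1) \<Longrightarrow> j' = j"
    by auto
  show ?thesis
  proof (rule ex1I[of _ "(\<lfloor>x + of_int j * lam'\<rfloor>, j)"], goal_cases)
    case 1
    show ?case unfolding fst_conv snd_conv iff using j(1) by blast
  next
    case (2 ij)
    then show ?case unfolding iff using j(2) by (metis prod.collapse)
  qed
qed

end

section \<open>The index of a sublattice of the integer lattice\<close>

text \<open>For the basis \<open>(g, h)\<close>, \<open>(0, d)\<close>: the residue of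
  \<open>m\<close> modulo \<open>g\<close> fixes the multiple of the first vector, and what remains
  of \<open>n\<close> is then reduced modulo \<open>d\<close>.\<close>

lemma triangular_transversal:
  fixes g h d :: int
  assumes "g \<noteq> 0" and "d \<noteq> 0"
  shows "\<exists>!s. s \<in> {0..<\<bar>g\<bar>} \<times> {0..<\<bar>d\<bar>} \<and> (\<exists>i j. m = fst s + i * g \<and> n = snd s + i * h + j * d)"
proof -
  have rem: "s = m mod \<bar>g\<bar>" if "s \<in> {0..<\<bar>g\<bar>}" "m = s + i * g" for s m i g :: int
  proof -
    have "m = s + (i * sgn g) * \<bar>g\<bar>" using that(2) by (simp add: abs_sgn)
    then show ?thesis using that(1) by simp
  qed
  have ex: "\<exists>i. m = m mod \<bar>g\<bar> + i * g" for m g :: int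
  proof
    show "m = m mod \<bar>g\<bar> + (m div \<bar>g\<bar> * sgn g) * g"
      using mod_div_mult_eq[of m "\<bar>g\<bar>"] by (simp add: abs_sgn mult.assoc mult.commute[of g])
  qed
  obtain i where i: "m = m mod \<bar>g\<bar> + i * g" using ex by blast
  obtain j where j: "n - i * h = (n - i * h) mod \<bar>d\<bar> + j * d" using ex by blast
  show ?thesis
  proof (rule ex1I[of _ "(m mod \<bar>g\<bar>, (n - i * h) mod \<bar>d\<bar>)"], goal_cases)
    case 1
    have "n = (n - i * h) mod \<bar>d\<bar> + i * h + j * d" using j by linarith
    then show ?case using assms i by auto
  next
    case (2 s)
    then obtain i' j' where "m = fst s + i' * g" "n = snd s + i' * h + j' * d" by blast
    moreover have "fst s \<in> {0..<\<bar>g\<bar>}" "snd s \<in> {0..<\<bar>d\<bar>}" using 2 by (auto simp: mem_Times_iff)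
    ultimately have s: "fst s \<in> {0..<\<bar>g\<bar>}" "snd s \<in> {0..<\<bar>d\<bar>}"
      "m = fst s + i' * g" "n = snd s + i' * h + j' * d"
      by simp_all
    have 1: "fst s = m mod \<bar>g\<bar>" using rem[OF s(1,3)] .
    then have "i' * g = i * g" using s(3) i by linarith
    then have i': "i' = i" using assms by simp
    have "n - i * h = snd s + j' * d" using s(4) unfolding i' by linarith
    with 1 show ?case using rem[OF s(2)] by (simp add: prod_eq_iff)
  qed
qed

text \<open>Reduction to Hermite normal form: a Bezout combination of the two vectors has the gcd as
  first coordinate, the complementary combination has 0.\<close>

lemma lattice_transversal:
  fixes p q p' q' :: int
  assumes det: "p * q' - q * p' \<noteq> 0"
  shows "\<exists>S. finite S \<and> card S = nat \<bar>p * q' - q * p'\<bar> \<and>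
    (\<forall>m n. \<exists>!s. s \<in> S \<and> (\<exists>i j. m = fst s + i * p + j * p' \<and> n = snd s + i * q + j * q'))"
proof -
  define g where "g = gcd p p'"
  have "g \<noteq> 0" using det by (auto simp: g_def)
  obtain a b where ab: "a * p + b * p' = g" unfolding g_def using bezout_int by blast
  obtain k k' where k: "p = k * g" "p' = k' * g"
    unfolding g_def by (metis dvdE gcd_dvd1 gcd_dvd2 mult.commute)
  have "(a * k + b * k') * g = 1 * g" using ab by (simp add: k algebra_simps)
  \<comment> \<open>The base change with rows \<open>(a, b)\<close> and \<open>(- k', k)\<close> has
    determinant 1 and produces \<open>(g, h)\<close> and \<open>(0, d)\<close>.\<close>
  then have unimod: "a * k + b * k' = 1" using \<open>g \<noteq> 0\<close> by (simp only: mult_cancel_right) blast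
  define h where "h = a * q + b * q'"
  define d where "d = k * q' - k' * q"
  have gd: "g * d = p * q' - q * p'" by (simp add: d_def k algebra_simps)
  then have "d \<noteq> 0" using det by auto
  have basis: "(\<exists>i j. m = s + i * p + j * p' \<and> n = t + i * q + j * q') \<longleftrightarrow>
      (\<exists>i j. m = s + i * g \<and> n = t + i * h + j * d)" for m n s t
  proof (intro iffI; elim exE conjE)
    fix i j assume *: "m = s + i * p + j * p'" "n = t + i * q + j * q'"
    show "\<exists>i j. m = s + i * g \<and> n = t + i * h + j * d"
    proof (intro exI conjI)
      show "m = s + (i * k + j * k') * g" by (simp add: *(1) k algebra_simps)
      have "i * q + j * q' = (i * q + j * q') * (a * k + b * k')" by (simp add: unimod)
      also have "\<dots> = (i * k + j * k') * h + (a * j - b * i) * d"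
        unfolding h_def d_def by algebra
      finally show "n = t + (i * k + j * k') * h + (a * j - b * i) * d" using *(2) by linarith
    qed
  next
    fix i j assume *: "m = s + i * g" "n = t + i * h + j * d"
    show "\<exists>i j. m = s + i * p + j * p' \<and> n = t + i * q + j * q'"
    proof (intro exI conjI)
      have "(i * a - j * k') * p + (i * b + j * k) * p' = i * (a * p + b * p')"
        by (simp add: k algebra_simps)
      also have "\<dots> = i * g" by (simp only: ab)
      finally have "(i * a - j * k') * p + (i * b + j * k) * p' = i * g" .
      then show "m = s + (i * a - j * k') * p + (i * b + j * k) * p'" using *(1) by linarith
      show "n = t + (i * a - j * k') * q + (i * b + j * k) * q'"
        unfolding *(2) h_def d_def by (simp add: algebra_simps)
    qed
  qed
  show ?thesis
  proof (intro exI conjI allI)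
    let ?S = "{0..<\<bar>g\<bar>} \<times> {0..<\<bar>d\<bar>}"
    show "finite ?S" by simp
    show "card ?S = nat \<bar>p * q' - q * p'\<bar>"
      by (simp add: abs_mult nat_mult_distrib flip: gd)
    show "\<exists>!s. s \<in> ?S \<and> (\<exists>i j. m = fst s + i * p + j * p' \<and> n = snd s + i * q + j * q')" for m n
      unfolding basis by (rule triangular_transversal[OF \<open>g \<noteq> 0\<close> \<open>d \<noteq> 0\<close>])
  qed
qed

section \<open>The geometry of the automorphism\<close>

lemma sum_int_symmetric:
  fixes g :: "int \<Rightarrow> 'a::comm_monoid_add"
  shows "(\<Sum>n = - int N..int N. g n) = (\<Sum>k<N. g (1 + int k)) + (\<Sum>k<Suc N. g (- int k))"
proof (induction N)
  case (Suc N)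
  have "{- int (Suc N)..int (Suc N)} = insert (- int (Suc N)) (insert (1 + int N) {- int N..int N})"
    by auto
  then have "(\<Sum>n = - int (Suc N)..int (Suc N). g n) =
      g (- int (Suc N)) + (g (1 + int N) + (\<Sum>n = - int N..int N. g n))"
    by simp
  then show ?case using Suc by (simp add: ac_simps)
qed simp

section \<open>Integer vectors and the covering of the torus\<close>

definition ivec :: "int \<times> int \<Rightarrow> real^2" where
  "ivec s = vector [of_int (fst s), of_int (snd s)]"

lemma ivec_nth [simp]: "ivec s $ 1 = of_int (fst s)" "ivec s $ 2 = of_int (snd s)"
  by (simp_all add: ivec_def)

lemma ivec_add: "ivec s + ivec s' = ivec (fst s + fst s', snd s + snd s')"
  and ivec_diff: "ivec s - ivec s' = ivec (fst s - fst s', snd s - snd s')"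
  and ivec_scale: "of_int i *\<^sub>R ivec s = ivec (i * fst s, i * snd s)"
  by (simp_all add: vec_eq_iff forall_2)

lemma ivec_eq_iff: "ivec s = ivec s' \<longleftrightarrow> s = s'"
  by (auto simp: vec_eq_iff forall_2 prod_eq_iff)

lemma torus_of_eq_iff_ivec: "torus_of x = torus_of y \<longleftrightarrow> (\<exists>s. x = y + ivec s)"
proof -
  have "(\<exists>s. x = y + ivec s) \<longleftrightarrow> (\<exists>m n. x $ 1 - y $ 1 = of_int m \<and> x $ 2 - y $ 2 = of_int n)"
    by (auto simp: vec_eq_iff forall_2 algebra_simps)
  then show ?thesis
    unfolding torus_of_eq_iff int_congruent_def forall_2 by (auto elim!: Ints_cases)
qed

lemma torus_of_add_ivec: "torus_of (x + ivec s) = torus_of x"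
  unfolding torus_of_eq_iff_ivec by blast

lemma continuous_torus_of: "continuous_on UNIV torus_of"
  by (simp add: continuous_on_open_vimage open_torus_def)

lemma tendsto_torus_of: "(f \<longlongrightarrow> x) F \<Longrightarrow> ((\<lambda>n. torus_of (f n)) \<longlongrightarrow> torus_of x) F"
  by (rule continuous_on_tendsto_compose[OF continuous_torus_of]) simp_all

text \<open>On the side of \<open>r\<close> dictated by \<open>\<sigma>\<close>, the nearest
  candidate \<open>r - 1\<close> or \<open>r + 1\<close> for \<open>|k|\<close> fails by parity, and
  the squares beyond it are more than 4 away from that of \<open>r\<close>. This is what keeps
  nonzero integer vectors off the eigenlines.\<close>

lemma not_square_discr:
  fixes r \<sigma> k :: int
  assumes "\<sigma> = 1 \<or> \<sigma> = - 1" and "1 \<le> r" and "\<sigma> = 1 \<Longrightarrow> 3 \<le> r"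
  shows "r\<^sup>2 - 4 * \<sigma> \<noteq> k\<^sup>2"
proof
  assume *: "r\<^sup>2 - 4 * \<sigma> = k\<^sup>2"
  define k' where "k' = \<bar>k\<bar>"
  have k': "r * r - 4 * \<sigma> = k' * k'" "0 \<le> k'"
    using * by (simp_all add: k'_def power2_eq_square)
  show False using assms(1)
  proof
    assume \<sigma>: "\<sigma> = 1"
    have "k' < r" using k' \<sigma> assms(2) mult_mono[of r k' r k'] by (intro not_le_imp_less notI) auto
    then consider "k' = r - 1" | "k' \<le> r - 2" by linarith
    then show False
    proof cases
      case 1
      have "2 * r = 5" using k'(1) unfolding \<sigma> 1 by (simp add: algebra_simps)
      then show False by presburger
    next
      case 2
      then have "k' * k' \<le> (r - 2) * (r - 2)" using k'(2) by (intro mult_mono) auto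
      then show False using k'(1) \<sigma> assms(3) by (simp add: algebra_simps)
    qed
  next
    assume \<sigma>: "\<sigma> = - 1"
    have "r < k'" using k' \<sigma> assms(2) mult_mono[of k' r k' r] by (intro not_le_imp_less notI) auto
    then consider "k' = r + 1" | "r + 2 \<le> k'" by linarith
    then show False
    proof cases
      case 1
      have "2 * r = - 1 + 4" using k'(1) unfolding \<sigma> 1 by (simp add: algebra_simps)
      then show False by presburger
    next
      case 2
      then have "(r + 2) * (r + 2) \<le> k' * k'" using assms(2) by (intro mult_mono) auto
      then show False using k'(1) \<sigma> assms(2) by (simp add: algebra_simps)
    qed
  qed
qed

lemma det_pm1_if_invertible:
  fixes M :: "int^'n^'n"
  assumes "invertible M"
  shows "det M = 1 \<or> det M = - 1"
proof -
  obtain A where "M ** A = mat 1" using assms unfolding invertible_def by blast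
  then have "det M * det A = 1" by (metis det_mul det_I)
  then show ?thesis using zmult_eq_1_iff by blast
qed

text \<open>With determinant 1 and trace 1 or 2 the characteristic polynomial has a root on the unit
  circle: a primitive sixth root of unity, or 1. An explicit eigenvector then contradicts
  hyperbolicity.\<close>

lemma trace_ge_3_if_hyperbolic:
  fixes M :: "int^2^2"
  assumes hyp: "hyperbolic M" and "trace M > 0" and det: "det M = 1"
  shows "3 \<le> trace M"
proof (rule ccontr)
  assume "\<not> 3 \<le> trace M"
  then have tr: "trace M = 1 \<or> trace M = 2" using assms(2) by linarith
  define \<mu> :: complex where "\<mu> = (if trace M = 1 then Complex (1/2) (sqrt 3 / 2) else 1)"
  have "cmod \<mu> = 1" by (simp add: \<mu>_def cmod_def power_divide)
  have "\<mu> * \<mu> - of_int (trace M) * \<mu> + 1 = 0"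
    using tr by (auto simp: \<mu>_def complex_eq_iff)
  then have \<mu>: "\<mu> * \<mu> = (of_int (M$1$1) + of_int (M$2$2)) * \<mu> - 1"
    by (simp add: trace_def sum_2 algebra_simps)
  have "(of_int (det M) :: complex) = 1" using det by simp
  then have cb: "of_int (M$2$1) * of_int (M$1$2) = of_int (M$1$1) * of_int (M$2$2) - (1 :: complex)"
    by (simp add: det_2 algebra_simps)
  \<comment> \<open>The usual eigenvector may vanish when \<open>M$1$2 = 0\<close>; the matrix is
    then triangular with unit diagonal and \<open>(0, 1)\<close> serves instead.\<close>
  have "\<exists>v. v \<noteq> 0 \<and> map_matrix of_int M *v v = \<mu> *s v"
  proof (cases "M$1$2 = 0")
    case False
    let ?v = "vector [of_int (M$1$2), \<mu> - of_int (M$1$1)] :: complex^2"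
    have "?v \<noteq> 0" using False by (auto simp: vec_eq_iff forall_2)
    moreover have "of_int (M$2$1) * of_int (M$1$2) + of_int (M$2$2) * (\<mu> - of_int (M$1$1)) =
        \<mu> * (\<mu> - of_int (M$1$1))"
      using \<mu> cb by algebra
    then have "map_matrix of_int M *v ?v = \<mu> *s ?v"
      by (simp add: vec_eq_iff forall_2 matrix_vector_mult_def sum_2 algebra_simps)
    ultimately show ?thesis by blast
  next
    case True
    then have "M$1$1 * M$2$2 = 1" using det by (simp add: det_2)
    then have 1: "M$1$1 = 1 \<and> M$2$2 = 1 \<or> M$1$1 = - 1 \<and> M$2$2 = - 1" using zmult_eq_1_iff by blast
    then have d: "M$2$2 = 1" using assms(2) by (auto simp: trace_def sum_2)
    then have "\<mu> = 1" using 1 by (auto simp: \<mu>_def trace_def sum_2)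
    let ?v = "vector [0, 1] :: complex^2"
    have "?v \<noteq> 0" by (auto simp: vec_eq_iff forall_2)
    moreover have "map_matrix of_int M *v ?v = \<mu> *s ?v"
      by (simp add: vec_eq_iff forall_2 matrix_vector_mult_def sum_2 True d \<open>\<mu> = 1\<close>)
    ultimately show ?thesis by blast
  qed
  then show False using hyp \<open>cmod \<mu> = 1\<close> unfolding hyperbolic_def by blast
qed

section \<open>Eigenlines and the determinant form of a lattice vector\<close>

locale hyperbolic_toral_automorphism =
  fixes M :: "int^2^2"
  assumes invertible: "invertible M" and hyperbolic: "hyperbolic M" and trace_pos: "trace M > 0"
begin

lemma discr_pos: "0 < discr M"
proof -
  have "3 * 3 \<le> trace M * trace M" if "det M = 1"
    using trace_ge_3_if_hyperbolic[OF hyperbolic trace_pos that] by (intro mult_mono) auto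
  moreover have "0 \<le> trace M * trace M" by simp
  ultimately show ?thesis
    using det_pm1_if_invertible[OF invertible] unfolding discr_def power2_eq_square by linarith
qed

lemma discr_not_square: "discr M \<noteq> k\<^sup>2"
  unfolding discr_def
  by (rule not_square_discr[OF det_pm1_if_invertible[OF invertible]])
    (use trace_pos trace_ge_3_if_hyperbolic[OF hyperbolic] in auto)

sublocale quadratic_unit "trace M" "det M" "dom_eig M"
proof
  show "det M = 1 \<or> det M = - 1" by (rule det_pm1_if_invertible[OF invertible])
  show "1 \<le> trace M" using trace_pos by simp
  show "3 \<le> trace M" if "det M = 1" by (rule trace_ge_3_if_hyperbolic[OF hyperbolic trace_pos that])
  have sq: "sqrt (of_int (discr M)) * sqrt (of_int (discr M)) = (of_int (discr M) :: real)"
    using discr_pos by simp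
  show "dom_eig M * dom_eig M = of_int (trace M) * dom_eig M - of_int (det M)"
    using sq unfolding dom_eig_def by (simp add: discr_def field_simps power2_eq_square)
  show "1 < dom_eig M"
  proof (cases "det M = 1")
    case True
    then have "3 \<le> trace M" by (rule trace_ge_3_if_hyperbolic[OF hyperbolic trace_pos])
    then have "2 < (of_int (trace M) :: real)" by linarith
    also have "\<dots> < of_int (trace M) + sqrt (of_int (discr M))" using discr_pos by simp
    finally show ?thesis unfolding dom_eig_def by simp
  next
    case False
    then have "det M = - 1" using det_pm1_if_invertible[OF invertible] by blast
    then have "4 \<le> discr M" by (simp add: discr_def)
    then have "2 \<le> sqrt (of_int (discr M) :: real)" by (intro real_le_rsqrt) simp
    then show ?thesis unfolding dom_eig_def using trace_pos by simp
  qed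
qed

abbreviation "lam \<equiv> dom_eig M"
abbreviation "sD \<equiv> sqrt (of_int (discr M) :: real)"
abbreviation "MR \<equiv> map_matrix real_of_int M"

lemma sD_pos: "0 < sD" using discr_pos by simp

lemma lam_minus_lam': "lam - lam' = sD"
  unfolding lam'_alt by (simp add: dom_eig_def field_simps)

lemma lam_times_lam': "lam * lam' = of_int (det M)"
  using lam_gt_1 by (simp add: lam'_def)

lemma MR_nth: "(MR *v x) $ 1 = of_int (M$1$1) * x $ 1 + of_int (M$1$2) * x $ 2"
  "(MR *v x) $ 2 = of_int (M$2$1) * x $ 1 + of_int (M$2$2) * x $ 2"
  by (simp_all add: matrix_vector_mult_def sum_2)

lemma Cayley_Hamilton: "MR *v (MR *v x) = of_int (trace M) *\<^sub>R (MR *v x) - of_int (det M) *\<^sub>R x"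
  by (simp add: vec_eq_iff forall_2 MR_nth trace_def sum_2 det_2 algebra_simps)

definition act :: "int \<times> int \<Rightarrow> int \<times> int" where
  "act s = (M$1$1 * fst s + M$1$2 * snd s, M$2$1 * fst s + M$2$2 * snd s)"

lemma MR_ivec: "MR *v ivec s = ivec (act s)"
  by (simp add: vec_eq_iff forall_2 MR_nth act_def)

text \<open>The projection onto the eigenline of \<open>lam\<close> along the one of \<open>lam'\<close>.\<close>

definition proj :: "real^2 \<Rightarrow> real^2" where
  "proj z = (1 / sD) *\<^sub>R (MR *v z - lam' *\<^sub>R z)"

lemma linear_proj: "linear proj"
  unfolding proj_def
  by (intro linear_compose_scale_right linear_compose_sub matrix_vector_mul_linear linear_scaleR)

text \<open>By Cayley-Hamilton the product of \<open>M - lam\<close> and \<open>M - lam'\<close>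
  vanishes, so \<open>M - lam'\<close> maps everything into the
  \<open>lam\<close>-eigenline.\<close>

lemma MR_proj: "MR *v proj z = lam *\<^sub>R proj z"
proof -
  have "MR *v (MR *v z - lam' *\<^sub>R z) = lam *\<^sub>R (MR *v z - lam' *\<^sub>R z)"
    unfolding matrix_vector_mult_diff_distrib matrix_vector_mult_scaleR Cayley_Hamilton
      scaleR_diff_right scaleR_scaleR lam_times_lam'
    by (simp add: lam'_alt algebra_simps)
  then show ?thesis by (simp add: proj_def matrix_vector_mult_scaleR scaleR_left_commute)
qed

lemma proj_minus: "proj z - z = (1 / sD) *\<^sub>R (MR *v z - lam *\<^sub>R z)"
proof -
  have "z = (1 / sD) *\<^sub>R ((lam - lam') *\<^sub>R z)" using sD_pos by (simp add: lam_minus_lam')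
  then have "proj z - z = (1 / sD) *\<^sub>R (MR *v z - lam' *\<^sub>R z) - (1 / sD) *\<^sub>R ((lam - lam') *\<^sub>R z)"
    by (simp only: proj_def)
  then show ?thesis by (simp add: algebra_simps)
qed

lemma MR_proj_minus: "MR *v (proj z - z) = lam' *\<^sub>R (proj z - z)"
proof -
  have "MR *v (MR *v z - lam *\<^sub>R z) = lam' *\<^sub>R (MR *v z - lam *\<^sub>R z)"
    unfolding matrix_vector_mult_diff_distrib matrix_vector_mult_scaleR Cayley_Hamilton
      scaleR_diff_right scaleR_scaleR lam_times_lam' mult.commute[of lam']
    by (simp add: lam'_alt algebra_simps)
  then show ?thesis by (simp add: proj_minus matrix_vector_mult_scaleR scaleR_left_commute)
qed

lemma proj_MR: "proj (MR *v z) = lam *\<^sub>R proj z"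
proof -
  have "proj (MR *v z) = MR *v proj z"
    by (simp only: proj_def matrix_vector_mult_scaleR matrix_vector_mult_diff_distrib)
  then show ?thesis by (simp only: MR_proj)
qed

text \<open>When nonzero, its absolute value is the index of the sublattice spanned by
  \<open>s\<close> and its image. As a quadratic form it is \<open>assoc_form\<close> up to sign and
  a quarter turn of the argument.\<close>

definition ldet :: "int \<times> int \<Rightarrow> int" where
  "ldet s = fst s * snd (act s) - snd s * fst (act s)"

text \<open>Completing the square, a zero makes \<open>discr M * q\<^sup>2\<close> a square, so
  \<open>q = 0\<close> since the discriminant is not one. For the same reason \<open>M$2$1\<close>
  is nonzero, and \<open>p = 0\<close> follows.\<close>

lemma ldet_eq_0_iff: "ldet s = 0 \<longleftrightarrow> s = (0, 0)"
proof
  assume *: "ldet s = 0"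
  obtain p q where s: "s = (p, q)" by fastforce
  define w where "w = 2 * M$2$1 * p + (M$2$2 - M$1$1) * q"
  have "discr M * q\<^sup>2 = w\<^sup>2 - 4 * M$2$1 * ldet s"
    unfolding discr_def ldet_def act_def w_def s
    by (simp add: trace_def sum_2 det_2 power2_eq_square algebra_simps)
  then have wq: "discr M * q\<^sup>2 = w\<^sup>2" using * by simp
  show "s = (0, 0)"
  proof (cases "q = 0")
    case False
    have "q\<^sup>2 dvd w\<^sup>2" using wq by (metis dvd_triv_right)
    then have "q dvd w" by simp
    then obtain k where "w = q * k" by blast
    then have "discr M = k\<^sup>2" using wq False by (simp add: power_mult_distrib)
    then show ?thesis using discr_not_square by blast
  next
    case True
    have "M$2$1 \<noteq> 0"
    proof
      assume "M$2$1 = 0"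
      then have "discr M = (M$1$1 - M$2$2)\<^sup>2"
        by (simp add: discr_def trace_def sum_2 det_2 power2_eq_square algebra_simps)
      then show False using discr_not_square by blast
    qed
    moreover have "M$2$1 * p * p = 0" using * True by (auto simp: ldet_def act_def s)
    ultimately show ?thesis using True s by simp
  qed
qed (simp add: ldet_def act_def)

lemma proj_ivec_eq_0_iff: "proj (ivec s) = 0 \<longleftrightarrow> s = (0, 0)"
proof
  assume "proj (ivec s) = 0"
  then have "ivec (act s) = lam' *\<^sub>R ivec s" using sD_pos by (simp add: proj_def MR_ivec)
  then have "of_int (fst (act s)) = lam' * of_int (fst s)" "of_int (snd (act s)) = lam' * of_int (snd s)"
    by (simp_all add: vec_eq_iff forall_2)
  then have "(of_int (ldet s) :: real) = 0" by (simp add: ldet_def algebra_simps)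
  then show "s = (0, 0)" by (simp add: ldet_eq_0_iff)
qed (simp add: proj_def vec_eq_iff forall_2 MR_nth)

lemma proj_ivec_inj: "proj (ivec s) = proj (ivec s') \<longleftrightarrow> s = s'"
proof -
  have "proj (ivec s) = proj (ivec s') \<longleftrightarrow> proj (ivec s - ivec s') = 0"
    by (simp add: linear_diff[OF linear_proj])
  then show ?thesis by (auto simp: ivec_diff proj_ivec_eq_0_iff prod_eq_iff)
qed

end

section \<open>Fibres of the coding\<close>

lemma real2_basis:
  fixes u v :: "real^2"
  assumes "u $ 1 * v $ 2 - u $ 2 * v $ 1 \<noteq> 0"
  shows "\<exists>!xy. p = fst xy *\<^sub>R u + snd xy *\<^sub>R v"
proof -
  define \<kappa> where "\<kappa> = u $ 1 * v $ 2 - u $ 2 * v $ 1"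
  have \<kappa>: "\<kappa> \<noteq> 0" using assms by (simp add: \<kappa>_def)
  have cramer: "fst xy * \<kappa> = q $ 1 * v $ 2 - q $ 2 * v $ 1" "snd xy * \<kappa> = u $ 1 * q $ 2 - u $ 2 * q $ 1"
    if "q = fst xy *\<^sub>R u + snd xy *\<^sub>R v" for q xy
    unfolding that \<kappa>_def by (simp_all add: algebra_simps)
  show ?thesis
  proof (rule ex1I)
    let ?xy = "((p $ 1 * v $ 2 - p $ 2 * v $ 1) / \<kappa>, (u $ 1 * p $ 2 - u $ 2 * p $ 1) / \<kappa>)"
    have "p $ i = ((p $ 1 * v $ 2 - p $ 2 * v $ 1) * u $ i + (u $ 1 * p $ 2 - u $ 2 * p $ 1) * v $ i) / \<kappa>" for i
      using \<kappa> exhaust_2[of i] unfolding eq_divide_eq by (auto simp: \<kappa>_def algebra_simps)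
    moreover have "(fst ?xy *\<^sub>R u + snd ?xy *\<^sub>R v) $ i =
        ((p $ 1 * v $ 2 - p $ 2 * v $ 1) * u $ i + (u $ 1 * p $ 2 - u $ 2 * p $ 1) * v $ i) / \<kappa>" for i
      by (simp add: add_divide_distrib)
    ultimately have "p $ i = (fst ?xy *\<^sub>R u + snd ?xy *\<^sub>R v) $ i" for i by (rule trans[OF _ sym])
    then show "p = fst ?xy *\<^sub>R u + snd ?xy *\<^sub>R v" by (intro vec_eq_iff[THEN iffD2] allI)
    fix xy assume "p = fst xy *\<^sub>R u + snd xy *\<^sub>R v"
    from cramer[OF this] show "xy = ?xy" using \<kappa> by (intro prod_eqI) (simp_all only: fst_conv snd_conv eq_divide_eq if_False not_False_eq_True if_True)
  qed
qed

lemma card_eq_if_unique_matching: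
  assumes "\<And>a. a \<in> A \<Longrightarrow> \<exists>!b. b \<in> B \<and> R a b" and "\<And>b. b \<in> B \<Longrightarrow> \<exists>!a. a \<in> A \<and> R a b" and "finite B"
  shows "finite A \<and> card A = card B"
proof -
  have "bij_betw (\<lambda>a. THE b. b \<in> B \<and> R a b) A B"
  proof (rule bij_betw_byWitness[where f' = "\<lambda>b. THE a. a \<in> A \<and> R a b"])
    have f: "(THE b. b \<in> B \<and> R a b) \<in> B \<and> R a (THE b. b \<in> B \<and> R a b)" if "a \<in> A" for a
      using theI'[OF assms(1)[OF that]] .
    have g: "(THE a. a \<in> A \<and> R a b) \<in> A \<and> R (THE a. a \<in> A \<and> R a b) b" if "b \<in> B" for b
      using theI'[OF assms(2)[OF that]] .
    show "\<forall>a\<in>A. (THE a'. a' \<in> A \<and> R a' (THE b. b \<in> B \<and> R a b)) = a"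
      using f g assms by blast
    show "\<forall>b\<in>B. (THE b'. b' \<in> B \<and> R (THE a. a \<in> A \<and> R a b) b') = b"
      using f g assms by blast
    show "(\<lambda>a. THE b. b \<in> B \<and> R a b) ` A \<subseteq> B" "(\<lambda>b. THE a. a \<in> A \<and> R a b) ` B \<subseteq> A"
      using f g by blast+
  qed
  then show ?thesis using assms(3) bij_betw_finite bij_betw_same_card by blast
qed

context hyperbolic_toral_automorphism
begin

lemma symb_compactum_eq: "symb_compactum M = two_sided (trace M) (det M)"
  by (simp add: symb_compactum_def two_sided_def Let_def)

lemma symb_digits:
  assumes "\<epsilon> \<in> symb_compactum M"
  shows "\<epsilon> n \<in> {0..trace M}"
proof -
  have "(\<forall>n. \<epsilon> n \<in> {0..trace M}) \<or> (\<forall>n. \<epsilon> n \<in> {0..trace M - 1})"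
    using assms unfolding symb_compactum_eq two_sided_def by (cases "det M = - 1") simp_all
  then show ?thesis by fastforce
qed

definition param :: "int \<times> int \<Rightarrow> real \<Rightarrow> real \<Rightarrow> real^2" where
  "param s x y = x *\<^sub>R proj (ivec s) + y *\<^sub>R (proj (ivec s) - ivec s)"

text \<open>Apply the matrix k times to \<open>t = (t - z) + z\<close>: \<open>t\<close> is scaled
  by \<open>lam\<close>, \<open>t - z\<close> by \<open>lam'\<close>, and \<open>z\<close> stays
  integral. On the torus this turns growing powers of \<open>lam\<close> into decaying powers of
  \<open>lam'\<close>.\<close>

lemma power_lam_proj:
  "lam ^ k *\<^sub>R proj (ivec s) = lam' ^ k *\<^sub>R (proj (ivec s) - ivec s) + ivec ((act ^^ k) s)"
proof (induction k)
  case (Suc k)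
  have "lam ^ Suc k *\<^sub>R proj (ivec s) = MR *v (lam ^ k *\<^sub>R proj (ivec s))"
    by (simp add: matrix_vector_mult_scaleR MR_proj mult.commute)
  also have "\<dots> = lam' ^ k *\<^sub>R (MR *v (proj (ivec s) - ivec s)) + MR *v ivec ((act ^^ k) s)"
    unfolding Suc by (simp only: matrix_vector_right_distrib matrix_vector_mult_scaleR)
  also have "\<dots> = lam' ^ Suc k *\<^sub>R (proj (ivec s) - ivec s) + ivec ((act ^^ Suc k) s)"
    unfolding MR_proj_minus MR_ivec by (simp add: mult.commute)
  finally show ?case .
qed simp

lemma sum_ivec: "\<exists>s. (\<Sum>k<(n::nat). of_int (c k) *\<^sub>R ivec (f k)) = ivec s"
proof (induction n)
  case 0
  have "0 = ivec (0, 0)" by (simp add: vec_eq_iff forall_2)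
  then show ?case by auto
next
  case (Suc n)
  then obtain s where "(\<Sum>k<n. of_int (c k) *\<^sub>R ivec (f k)) = ivec s" by blast
  then have "(\<Sum>k<Suc n. of_int (c k) *\<^sub>R ivec (f k)) =
      ivec (fst s + c n * fst (f n), snd s + c n * snd (f n))"
    by (simp only: sum.lessThan_Suc ivec_scale ivec_add fst_conv snd_conv)
  then show ?case by blast
qed

text \<open>Already the partial sums agree on the torus with sums that converge in the plane.
  Continuity of the covering and uniqueness of limits on the Hausdorff torus then evaluate
  \<open>lim\<close>.\<close>

lemma coding_proj:
  assumes "\<epsilon> \<in> symb_compactum M"
  shows "coding M (proj (ivec s)) \<epsilon> = torus_of (param s (fut \<epsilon>) (past \<epsilon>))"
proof -
  let ?t = "proj (ivec s)"
  define A where "A N = (\<Sum>k<N. of_int (\<epsilon> (1 + int k)) * (1 / lam) ^ k) / lam" for N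
  define B where "B N = (\<Sum>k<N. of_int (\<epsilon> (- int k)) * lam' ^ k)" for N
  have "(\<lambda>N. \<Sum>k<N. of_int (\<epsilon> (1 + int k)) * (1 / lam) ^ k) \<longlonglongrightarrow> digit_sum (1 / lam) (\<lambda>k. \<epsilon> (1 + int k))"
    unfolding digit_sum_def using lam_gt_1
    by (intro summable_LIMSEQ summable_digits[OF _ symb_digits[OF assms]]) simp
  then have "A \<longlonglongrightarrow> fut \<epsilon>"
    unfolding A_def fut_def using lam_gt_1 by (intro tendsto_divide tendsto_const) auto
  moreover have "B \<longlonglongrightarrow> past \<epsilon>"
    unfolding B_def past_def digit_sum_def
    by (rule summable_LIMSEQ[OF summable_digits[OF abs_lam' symb_digits[OF assms]]])
  ultimately have "(\<lambda>N. param s (A N) (B (Suc N))) \<longlonglongrightarrow> param s (fut \<epsilon>) (past \<epsilon>)"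
    unfolding param_def by (intro tendsto_intros LIMSEQ_Suc)
  \<comment> \<open>\<open>Suc N\<close> for the past because place 0 belongs to the left
    half.\<close>
  moreover have "torus_of ((\<Sum>n = - int N..int N. of_int (\<epsilon> n) * lam powi (- n)) *\<^sub>R ?t) =
      torus_of (param s (A N) (B (Suc N)))" for N
  proof -
    have pow1: "lam powi (- (1 + int k)) = (1 / lam) ^ k / lam" for k
      using lam_gt_1 by (simp add: power_int_def nat_add_distrib power_one_over divide_inverse mult.commute)
    have pow2: "lam powi (- (- int k)) = lam ^ k" for k by simp
    obtain s' where s': "(\<Sum>k<Suc N. of_int (\<epsilon> (- int k)) *\<^sub>R ivec ((act ^^ k) s)) = ivec s'"
      using sum_ivec[of "\<lambda>k. \<epsilon> (- int k)" "\<lambda>k. (act ^^ k) s" "Suc N"] by blast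
    have "(\<Sum>n = - int N..int N. of_int (\<epsilon> n) * lam powi (- n)) =
        A N + (\<Sum>k<Suc N. of_int (\<epsilon> (- int k)) * lam ^ k)"
      unfolding sum_int_symmetric pow1 pow2 A_def sum_divide_distrib by simp
    also have "\<dots> *\<^sub>R ?t = A N *\<^sub>R ?t + (\<Sum>k<Suc N. of_int (\<epsilon> (- int k)) *\<^sub>R (lam ^ k *\<^sub>R ?t))"
      by (simp only: scaleR_add_left scaleR_sum_left scaleR_scaleR)
    also have "\<dots> = param s (A N) (B (Suc N)) + ivec s'"
      unfolding power_lam_proj scaleR_add_right sum.distrib s' scaleR_scaleR param_def B_def scaleR_sum_left
      by (simp only: add.assoc)
    finally show ?thesis by (simp only: torus_of_add_ivec)
  qed
  ultimately have "(\<lambda>N. torus_of ((\<Sum>n = - int N..int N. of_int (\<epsilon> n) * lam powi (- n)) *\<^sub>R ?t))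
      \<longlonglongrightarrow> torus_of (param s (fut \<epsilon>) (past \<epsilon>))"
    by (simp only: tendsto_torus_of)
  then show ?thesis unfolding coding_def using assms by (simp add: limI)
qed

text \<open>The determinant of the two direction vectors is \<open>ldet s / sD\<close>.\<close>

lemma param_unique:
  assumes "s \<noteq> (0, 0)"
  shows "\<exists>!xy. p = param s (fst xy) (snd xy)"
proof -
  let ?t = "proj (ivec s)"
  have cross: "e * (a - lam' * p) * (e * (b - lam * q)) - e * (b - lam' * q) * (e * (a - lam * p)) =
      e * e * ((lam - lam') * (p * b - q * a))" for a b p q e :: real
    by algebra
  have t: "?t $ 1 = 1 / sD * (of_int (fst (act s)) - lam' * of_int (fst s))"
    "?t $ 2 = 1 / sD * (of_int (snd (act s)) - lam' * of_int (snd s))"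
    "(?t - ivec s) $ 1 = 1 / sD * (of_int (fst (act s)) - lam * of_int (fst s))"
    "(?t - ivec s) $ 2 = 1 / sD * (of_int (snd (act s)) - lam * of_int (snd s))"
    unfolding proj_minus by (simp_all add: proj_def MR_ivec)
  have "?t $ 1 * (?t - ivec s) $ 2 - ?t $ 2 * (?t - ivec s) $ 1 =
      1 / sD * (1 / sD) * (sD * of_int (ldet s))"
    unfolding t cross lam_minus_lam' ldet_def by simp
  moreover have "ldet s \<noteq> 0" using assms by (simp add: ldet_eq_0_iff)
  ultimately show ?thesis
    unfolding param_def using sD_pos by (intro real2_basis) simp
qed

text \<open>Identifies the translations of \<open>tile_translates\<close> with the sublattice
  spanned by \<open>ivec s\<close> and its image.\<close>

lemma param_shift:
  "param s (x - of_int i + of_int j * lam') (y + of_int i - of_int j * lam) =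
    param s x y - of_int i *\<^sub>R ivec s - of_int j *\<^sub>R (ivec (act s) - of_int (trace M) *\<^sub>R ivec s)"
proof -
  have "sD *\<^sub>R proj (ivec s) = MR *v ivec s - lam' *\<^sub>R ivec s"
    using sD_pos by (simp add: proj_def)
  then have act: "ivec (act s) = (lam - lam') *\<^sub>R proj (ivec s) + lam' *\<^sub>R ivec s"
    by (simp add: lam_minus_lam' MR_ivec)
  have "of_int (trace M) = lam + lam'" by (simp add: lam'_alt)
  then show ?thesis unfolding param_def act by (simp add: algebra_simps)
qed

text \<open>A sequence in the fibre gives a lift \<open>p + ivec l\<close> and is matched with the
  representative of l modulo the sublattice. Conversely each \<open>p + ivec \<tau>\<close> has
  exactly one translate in the tile, and that point has exactly one sequence. The hypothesis
  \<open>generic\<close> concerns all lifts of the torus point, hence all these translates.\<close>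

lemma card_coding_fibre:
  assumes s: "s \<noteq> (0, 0)"
    and sound: "\<And>\<epsilon>. \<epsilon> \<in> symb_compactum M \<Longrightarrow> fut \<epsilon> \<notin> N1 \<Longrightarrow> past \<epsilon> \<notin> N2 \<Longrightarrow> (fut \<epsilon>, past \<epsilon>) \<in> tile"
    and complete: "\<And>x y. x \<notin> N1 \<Longrightarrow> y \<notin> N2 \<Longrightarrow> (x, y) \<in> tile \<Longrightarrow>
      \<exists>!\<epsilon>. \<epsilon> \<in> symb_compactum M \<and> fut \<epsilon> = x \<and> past \<epsilon> = y"
    and generic: "\<And>x y. torus_of (param s x y) = torus_of p \<Longrightarrow> x \<notin> N1 \<and> y \<notin> N2"
  shows "finite {\<epsilon> \<in> symb_compactum M. coding M (proj (ivec s)) \<epsilon> = torus_of p} \<and>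
    card {\<epsilon> \<in> symb_compactum M. coding M (proj (ivec s)) \<epsilon> = torus_of p} = nat \<bar>ldet s\<bar>"
proof -
  \<comment> \<open>Subtracting a multiple of \<open>s\<close> from its image changes neither the
    sublattice nor the determinant, but gives the generator that occurs in
    \<open>param_shift\<close>.\<close>
  define w where "w = (fst (act s) - trace M * fst s, snd (act s) - trace M * snd s)"
  have w: "ivec (act s) - of_int (trace M) *\<^sub>R ivec s = ivec w"
    by (simp add: w_def ivec_scale ivec_diff)
  have ldet_w: "fst s * snd w - snd s * fst w = ldet s"
    by (simp add: w_def ldet_def algebra_simps)
  then have "fst s * snd w - snd s * fst w \<noteq> 0" using s by (simp add: ldet_eq_0_iff)
  from lattice_transversal[OF this] obtain S where S: "finite S" "card S = nat \<bar>ldet s\<bar>"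
    "\<And>m n. \<exists>!\<tau>. \<tau> \<in> S \<and> (\<exists>i j. m = fst \<tau> + i * fst s + j * fst w \<and> n = snd \<tau> + i * snd s + j * snd w)"
    unfolding ldet_w by blast
  define rel where "rel \<epsilon> \<tau> \<longleftrightarrow>
    (\<exists>i j. param s (fut \<epsilon>) (past \<epsilon>) = p + ivec \<tau> - of_int i *\<^sub>R ivec s - of_int j *\<^sub>R ivec w)" for \<epsilon> \<tau>
  have rel_torus: "torus_of (param s (fut \<epsilon>) (past \<epsilon>)) = torus_of p" if rel: "rel \<epsilon> \<tau>" for \<epsilon> \<tau>
  proof -
    obtain i j where "param s (fut \<epsilon>) (past \<epsilon>) = p + ivec \<tau> - of_int i *\<^sub>R ivec s - of_int j *\<^sub>R ivec w"
      using rel unfolding rel_def by blast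
    then have "param s (fut \<epsilon>) (past \<epsilon>) = p + (ivec \<tau> - of_int i *\<^sub>R ivec s - of_int j *\<^sub>R ivec w)"
      by (simp only: add_diff_eq)
    then show ?thesis by (simp only: ivec_scale ivec_diff torus_of_add_ivec)
  qed
  let ?F = "{\<epsilon> \<in> symb_compactum M. coding M (proj (ivec s)) \<epsilon> = torus_of p}"
  have "finite ?F \<and> card ?F = card S"
  proof (rule card_eq_if_unique_matching[where R = rel])
    fix \<epsilon> assume "\<epsilon> \<in> ?F"
    then have "torus_of (param s (fut \<epsilon>) (past \<epsilon>)) = torus_of p" by (auto simp: coding_proj)
    then obtain l where l: "param s (fut \<epsilon>) (past \<epsilon>) = p + ivec l" unfolding torus_of_eq_iff_ivec by blast
    have "rel \<epsilon> \<tau> \<longleftrightarrow> (\<exists>i j. fst l = fst \<tau> + i * fst s + j * fst w \<and> snd l = snd \<tau> + i * snd s + j * snd w)" for \<tau>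
    proof -
      have "param s (fut \<epsilon>) (past \<epsilon>) = p + ivec \<tau> - of_int (- i) *\<^sub>R ivec s - of_int (- j) *\<^sub>R ivec w \<longleftrightarrow>
          fst l = fst \<tau> + i * fst s + j * fst w \<and> snd l = snd \<tau> + i * snd s + j * snd w" for i j
      proof -
        have "p + ivec \<tau> - of_int (- i) *\<^sub>R ivec s - of_int (- j) *\<^sub>R ivec w =
            p + ivec (fst \<tau> + i * fst s + j * fst w, snd \<tau> + i * snd s + j * snd w)"
          by (simp add: vec_eq_iff forall_2)
        then show ?thesis unfolding l by (simp add: ivec_eq_iff prod_eq_iff)
      qed
      then show ?thesis unfolding rel_def by (metis minus_minus)
    qed
    then show "\<exists>!\<tau>. \<tau> \<in> S \<and> rel \<epsilon> \<tau>" using S(3)[of "fst l" "snd l"] by simp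
  next
    fix \<tau> assume "\<tau> \<in> S"
    obtain xy where "p + ivec \<tau> = param s (fst xy) (snd xy)" using param_unique[OF s] by blast
    then obtain x y where xy: "p + ivec \<tau> = param s x y" by blast
    define X Y where "X i j = x - of_int i + of_int j * lam'" and "Y i j = y + of_int i - of_int j * lam" for i j :: int
    have shift: "param s (X i j) (Y i j) = p + ivec \<tau> - of_int i *\<^sub>R ivec s - of_int j *\<^sub>R ivec w" for i j
      unfolding X_def Y_def param_shift w xy ..
    have rel_iff: "rel \<epsilon> \<tau> \<longleftrightarrow> (\<exists>i j. fut \<epsilon> = X i j \<and> past \<epsilon> = Y i j)" for \<epsilon>
      unfolding rel_def shift[symmetric] using param_unique[OF s] by (metis fst_conv snd_conv)
    have gen: "X i j \<notin> N1 \<and> Y i j \<notin> N2" for i j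
    proof (rule generic)
      have "param s (X i j) (Y i j) = p + (ivec \<tau> - of_int i *\<^sub>R ivec s - of_int j *\<^sub>R ivec w)"
        unfolding shift by (simp only: add_diff_eq)
      then show "torus_of (param s (X i j) (Y i j)) = torus_of p"
        by (simp only: ivec_scale ivec_diff torus_of_add_ivec)
    qed
    obtain ij where ij: "(X (fst ij) (snd ij), Y (fst ij) (snd ij)) \<in> tile"
      "\<And>ij'. (X (fst ij') (snd ij'), Y (fst ij') (snd ij')) \<in> tile \<Longrightarrow> ij' = ij"
      using tile_translates[of x y] unfolding X_def Y_def by blast
    obtain \<epsilon> where \<epsilon>: "\<epsilon> \<in> symb_compactum M" "fut \<epsilon> = X (fst ij) (snd ij)" "past \<epsilon> = Y (fst ij) (snd ij)"
      "\<And>\<epsilon>'. \<epsilon>' \<in> symb_compactum M \<Longrightarrow> fut \<epsilon>' = X (fst ij) (snd ij) \<Longrightarrow> past \<epsilon>' = Y (fst ij) (snd ij) \<Longrightarrow> \<epsilon>' = \<epsilon>"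
      using complete[OF conjunct1[OF gen] conjunct2[OF gen] ij(1)] by blast
    show "\<exists>!\<epsilon>. \<epsilon> \<in> ?F \<and> rel \<epsilon> \<tau>"
    proof (rule ex1I[of _ \<epsilon>])
      have "rel \<epsilon> \<tau>" unfolding rel_iff using \<epsilon> by blast
      then show "\<epsilon> \<in> ?F \<and> rel \<epsilon> \<tau>" using \<epsilon>(1) rel_torus by (simp add: coding_proj)
      fix \<epsilon>' assume *: "\<epsilon>' \<in> ?F \<and> rel \<epsilon>' \<tau>"
      then obtain i j where ij': "fut \<epsilon>' = X i j" "past \<epsilon>' = Y i j" unfolding rel_iff by blast
      have "(X i j, Y i j) \<in> tile" using sound[of \<epsilon>'] * gen[of i j] ij' by simp
      then have "(i, j) = ij" by (intro ij(2)) simp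
      then show "\<epsilon>' = \<epsilon>" using \<epsilon>(4)[of \<epsilon>'] * ij' by auto
    qed
  qed (rule S)
  then show ?thesis by (simp only: S)
qed

end

section \<open>Null sets\<close>

lemma measurable_torus_of: "torus_of \<in> borel_measurable borel"
  by (rule borel_measurable_continuous_onI[OF continuous_torus_of])

lemma sets_unit_square: "{x :: real^2. \<forall>i. 0 \<le> x $ i \<and> x $ i < 1} \<in> sets borel"
proof -
  have [measurable]: "(\<lambda>x :: real^2. x $ i) \<in> borel_measurable borel" for i
    by (intro borel_measurable_continuous_onI continuous_intros)
  show ?thesis unfolding forall_2 by measurable
qed

lemma sets_torus_lebesgue: "sets torus_lebesgue = sets borel"
  and space_torus_lebesgue: "space torus_lebesgue = UNIV"
  by (simp_all add: torus_lebesgue_def)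

lemma emeasure_torus_lebesgue:
  assumes "B \<in> sets borel"
  shows "emeasure torus_lebesgue B = emeasure lborel (torus_of -` B \<inter> {x. \<forall>i. 0 \<le> x $ i \<and> x $ i < 1})"
  unfolding torus_lebesgue_def using assms sets_unit_square
  by (subst emeasure_distr)
    (auto intro!: measurable_restrict_space1 measurable_torus_of emeasure_restrict_space
      simp: space_restrict_space sets_restrict_space_iff measurable_sets_borel[OF measurable_torus_of])

lemma AE_torus_lebesgueI:
  assumes B: "B \<in> sets borel" and "negligible (torus_of -` B)" and "\<And>x. x \<notin> B \<Longrightarrow> P x"
  shows "AE x in torus_lebesgue. P x"
proof (rule AE_I')
  let ?Q = "{x :: real^2. \<forall>i. 0 \<le> x $ i \<and> x $ i < 1}"
  have "torus_of -` B \<inter> ?Q \<in> sets borel"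
    using measurable_sets_borel[OF measurable_torus_of B] sets_unit_square by blast
  moreover have "torus_of -` B \<inter> ?Q \<in> null_sets lebesgue"
    using negligible_subset[OF assms(2)] by (simp add: negligible_iff_null_sets[symmetric])
  ultimately have "emeasure lborel (torus_of -` B \<inter> ?Q) = 0"
    by (simp add: null_sets_completion_iff null_setsD1)
  then show "B \<in> null_sets torus_lebesgue"
    using B by (intro null_setsI) (simp_all only: emeasure_torus_lebesgue[OF B] sets_torus_lebesgue)
  show "{x \<in> space torus_lebesgue. \<not> P x} \<subseteq> B" using assms(3) by blast
qed

text \<open>The torus has positive measure; this is what makes the number of preimages well
  defined.\<close>

lemma AE_torus_lebesgue_const:
  assumes "AE x in torus_lebesgue. P"
  shows P
proof (rule ccontr)
  assume "\<not> P"
  with assms have "AE x in torus_lebesgue. False" by simp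
  then have "emeasure torus_lebesgue UNIV = 0"
    by (simp add: eventually_False ae_filter_eq_bot_iff space_torus_lebesgue)
  then have "emeasure lborel {x :: real^2. \<forall>i. 0 \<le> x $ i \<and> x $ i < 1} = 0"
    by (simp add: emeasure_torus_lebesgue)
  then have "negligible {x :: real^2. \<forall>i. 0 \<le> x $ i \<and> x $ i < 1}"
    using sets_unit_square by (simp add: negligible_iff_null_sets null_sets_def null_sets_completionI)
  then have "negligible (box 0 1 :: (real^2) set)"
    by (rule negligible_subset) (auto simp: mem_box_cart less_imp_le)
  moreover have "(1/2) *\<^sub>R 1 \<in> (box 0 1 :: (real^2) set)" by (simp add: mem_box_cart)
  ultimately show False using open_not_negligible[OF open_box] by blast
qed

lemma to_one_ae_unique:
  assumes "to_one_ae M \<phi> K" and "to_one_ae M \<phi> K'"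
  shows "K = K'"
proof (rule AE_torus_lebesgue_const)
  show "AE x in torus_lebesgue. K = K'"
    using assms unfolding to_one_ae_def by eventually_elim simp
qed

lemma negligible_line:
  fixes v :: "real^2"
  assumes "v \<noteq> 0"
  shows "negligible (range (\<lambda>y. q + y *\<^sub>R v))"
proof (rule negligible_subset)
  let ?a = "vector [v $ 2, - v $ 1] :: real^2"
  show "negligible {x. ?a \<bullet> x = ?a \<bullet> q}"
    using assms by (intro negligible_hyperplane) (auto simp: vec_eq_iff forall_2)
  show "range (\<lambda>y. q + y *\<^sub>R v) \<subseteq> {x. ?a \<bullet> x = ?a \<bullet> q}"
    by (auto simp: inner_vec_def sum_2 algebra_simps)
qed

text \<open>A line is a countable union of segments, whose images are compact, hence closed in the
  Hausdorff torus: this gives measurability. The full preimage is covered by countably many integer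
  translates of lines, hence null.\<close>

lemma torus_lines:
  fixes u v :: "real^2"
  assumes "countable N" and "v \<noteq> 0"
  defines "B \<equiv> torus_of ` (\<Union>x\<in>N. range (\<lambda>y. x *\<^sub>R u + y *\<^sub>R v))"
  shows "B \<in> sets borel" and "negligible (torus_of -` B)"
proof -
  have "range (\<lambda>y. x *\<^sub>R u + y *\<^sub>R v) = (\<Union>n. (\<lambda>y. x *\<^sub>R u + y *\<^sub>R v) ` {- real n..real n})" for x
  proof -
    have "\<exists>n. y \<in> {- real n..real n}" for y
    proof -
      obtain n where "\<bar>y\<bar> \<le> real n" using real_arch_simple by blast
      then have "y \<in> {- real n..real n}" by auto
      then show ?thesis by blast
    qed
    then show ?thesis by blast
  qed
  then have "B = (\<Union>x\<in>N. \<Union>n. torus_of ` (\<lambda>y. x *\<^sub>R u + y *\<^sub>R v) ` {- real n..real n})"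
    unfolding B_def by (simp add: image_UN)
  moreover have "closed (torus_of ` (\<lambda>y. x *\<^sub>R u + y *\<^sub>R v) ` {- real n..real n})" for x n
    by (intro compact_imp_closed compact_continuous_image continuous_intros
        continuous_on_subset[OF continuous_torus_of]) auto
  ultimately show "B \<in> sets borel"
    by (simp only:) (intro sets.countable_UN' assms(1) countableI_type image_subsetI borel_closed)
  have "torus_of -` B \<subseteq> (\<Union>x\<in>N. \<Union>s. range (\<lambda>y. (x *\<^sub>R u + ivec s) + y *\<^sub>R v))"
  proof
    fix p assume "p \<in> torus_of -` B"
    then obtain x y where "x \<in> N" "torus_of p = torus_of (x *\<^sub>R u + y *\<^sub>R v)" unfolding B_def by blast
    then obtain s where "p = x *\<^sub>R u + y *\<^sub>R v + ivec s" unfolding torus_of_eq_iff_ivec by blast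
    then have "p = (x *\<^sub>R u + ivec s) + y *\<^sub>R v" by (simp only: ac_simps)
    then show "p \<in> (\<Union>x\<in>N. \<Union>s. range (\<lambda>y. (x *\<^sub>R u + ivec s) + y *\<^sub>R v))"
      using \<open>x \<in> N\<close> by blast
  qed
  moreover have "negligible (\<Union>x\<in>N. \<Union>s. range (\<lambda>y. (x *\<^sub>R u + ivec s) + y *\<^sub>R v))"
    using assms(1,2) by (auto intro!: negligible_countable_Union negligible_line)
  ultimately show "negligible (torus_of -` B)" by (rule negligible_subset[rotated])
qed

context hyperbolic_toral_automorphism
begin

lemma to_one_ae_coding_proj:
  assumes s: "s \<noteq> (0, 0)"
  shows "to_one_ae M (coding M (proj (ivec s))) (nat \<bar>ldet s\<bar>)"
proof -
  obtain N1 N2 where fib: "countable N1" "countable N2"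
    "\<forall>\<epsilon>\<in>symb_compactum M. fut \<epsilon> \<notin> N1 \<and> past \<epsilon> \<notin> N2 \<longrightarrow> (fut \<epsilon>, past \<epsilon>) \<in> tile"
    "\<forall>x y. x \<notin> N1 \<and> y \<notin> N2 \<and> (x, y) \<in> tile \<longrightarrow>
      (\<exists>!\<epsilon>. \<epsilon> \<in> symb_compactum M \<and> fut \<epsilon> = x \<and> past \<epsilon> = y)"
    using two_sided_fibre unfolding symb_compactum_eq by (elim exE conjE)
  have N: "countable N1" "countable N2"
    "\<And>\<epsilon>. \<epsilon> \<in> symb_compactum M \<Longrightarrow> fut \<epsilon> \<notin> N1 \<Longrightarrow> past \<epsilon> \<notin> N2 \<Longrightarrow> (fut \<epsilon>, past \<epsilon>) \<in> tile"
    "\<And>x y. x \<notin> N1 \<Longrightarrow> y \<notin> N2 \<Longrightarrow> (x, y) \<in> tile \<Longrightarrow>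
      \<exists>!\<epsilon>. \<epsilon> \<in> symb_compactum M \<and> fut \<epsilon> = x \<and> past \<epsilon> = y"
    using fib by blast+
  let ?u = "proj (ivec s)" and ?v = "proj (ivec s) - ivec s"
  have "?u \<noteq> 0" using s by (simp add: proj_ivec_eq_0_iff)
  have "?v \<noteq> 0"
  proof
    assume "?v = 0"
    then have "param s 0 0 = param s 0 1" unfolding param_def by simp
    then show False using param_unique[OF s, of "param s 0 0"] by (metis fst_conv snd_conv zero_neq_one)
  qed
  \<comment> \<open>A future in \<open>N1\<close> puts the point on a line in direction
    \<open>?v\<close>, a past in \<open>N2\<close> on one in direction \<open>?u\<close>.\<close>
  let ?B1 = "torus_of ` (\<Union>x\<in>N1. range (\<lambda>y. x *\<^sub>R ?u + y *\<^sub>R ?v))"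
  let ?B2 = "torus_of ` (\<Union>y\<in>N2. range (\<lambda>x. y *\<^sub>R ?v + x *\<^sub>R ?u))"
  show ?thesis unfolding to_one_ae_def
  proof (rule AE_torus_lebesgueI)
    show "?B1 \<union> ?B2 \<in> sets borel"
      using torus_lines(1)[OF N(1) \<open>?v \<noteq> 0\<close>] torus_lines(1)[OF N(2) \<open>?u \<noteq> 0\<close>] by (rule sets.Un)
    show "negligible (torus_of -` (?B1 \<union> ?B2))"
      unfolding vimage_Un
      using torus_lines(2)[OF N(1) \<open>?v \<noteq> 0\<close>] torus_lines(2)[OF N(2) \<open>?u \<noteq> 0\<close>] by (rule negligible_Un)
    fix \<xi> assume \<xi>: "\<xi> \<notin> ?B1 \<union> ?B2"
    obtain p where p: "\<xi> = torus_of p" using torus_of_rep_torus by metis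
    have "x \<notin> N1 \<and> y \<notin> N2" if "torus_of (param s x y) = torus_of p" for x y
    proof -
      have "torus_of (param s x y) \<in> ?B1" if "x \<in> N1" unfolding param_def using that by blast
      moreover have "torus_of (param s x y) \<in> ?B2" if "y \<in> N2"
        unfolding param_def add.commute[of "x *\<^sub>R ?u"] using that by blast
      ultimately show ?thesis using \<xi> that unfolding p by (metis UnI1 UnI2)
    qed
    from card_coding_fibre[OF s N(3,4) this]
    show "finite {\<epsilon> \<in> symb_compactum M. coding M (proj (ivec s)) \<epsilon> = \<xi>} \<and>
      card {\<epsilon> \<in> symb_compactum M. coding M (proj (ivec s)) \<epsilon> = \<xi>} = nat \<bar>ldet s\<bar>"
      unfolding p by blast
  qed
qed

end

section \<open>Homoclinic points\<close>

lemma ivec_eq_0_if_small: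
  assumes "norm (ivec s) < 1"
  shows "s = (0, 0)"
proof -
  have "\<bar>ivec s $ i\<bar> < 1" for i
    using component_le_norm_cart[of "ivec s" i] assms by linarith
  from this[of 1] this[of 2] show ?thesis by (simp add: prod_eq_iff) linarith
qed

lemma open_torus_of_image:
  assumes "open U"
  shows "open (torus_of ` U)"
proof -
  have "torus_of -` torus_of ` U = (\<Union>s. (+) (ivec s) ` U)"
    by (auto simp: torus_of_eq_iff_ivec image_iff add.commute) blast+
  then show ?thesis
    using assms by (auto simp: open_torus_def intro!: open_UN open_translation)
qed

lemma map_matrix_of_int_mult:
  "map_matrix real_of_int (A ** B) = map_matrix real_of_int A ** map_matrix real_of_int B"
  by (simp add: vec_eq_iff matrix_matrix_mult_def)

lemma map_matrix_of_int_1: "map_matrix real_of_int (mat 1) = mat 1"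
  by (simp add: vec_eq_iff mat_def)

lemma toral_map_torus_of: "toral_map M (torus_of x) = torus_of (map_matrix real_of_int M *v x)"
  by (simp add: toral_map.abs_eq)

context hyperbolic_toral_automorphism
begin

definition inv_mat :: "int^2^2" where
  "inv_mat = (SOME A. M ** A = mat 1 \<and> A ** M = mat 1)"

lemma inv_mat: "M ** inv_mat = mat 1" "inv_mat ** M = mat 1"
  using someI_ex[OF invertible[unfolded invertible_def]] unfolding inv_mat_def by auto

abbreviation "IR \<equiv> map_matrix real_of_int inv_mat"

lemma IR_MR: "IR *v (MR *v x) = x" "MR *v (IR *v x) = x"
  by (simp_all add: matrix_vector_mul_assoc flip: map_matrix_of_int_mult)
    (simp_all add: inv_mat map_matrix_of_int_1)

definition iact :: "int \<times> int \<Rightarrow> int \<times> int" where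
  "iact s = (inv_mat$1$1 * fst s + inv_mat$1$2 * snd s, inv_mat$2$1 * fst s + inv_mat$2$2 * snd s)"

lemma IR_ivec: "IR *v ivec s = ivec (iact s)"
  by (simp add: vec_eq_iff forall_2 matrix_vector_mult_def sum_2 iact_def)

lemma act_iact: "act (iact s) = s" and iact_act: "iact (act s) = s"
  by (metis IR_MR IR_ivec MR_ivec ivec_eq_iff)+

lemma inv_toral_map: "inv (toral_map M) = toral_map inv_mat"
proof (rule inv_equality)
  show "toral_map inv_mat (toral_map M x) = x" for x
    by (metis IR_MR(1) toral_map_torus_of torus_of_rep_torus)
  show "toral_map M (toral_map inv_mat x) = x" for x
    by (metis IR_MR(2) toral_map_torus_of torus_of_rep_torus)
qed

lemma toral_map_pow_eigen:
  assumes "MR *v t = lam *\<^sub>R t"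
  shows "(toral_map M ^^ n) (torus_of t) = torus_of (lam ^ n *\<^sub>R t)"
    and "(inv (toral_map M) ^^ n) (torus_of t) = torus_of ((1 / lam) ^ n *\<^sub>R t)"
proof -
  have "IR *v t = (1 / lam) *\<^sub>R (IR *v (MR *v t))"
    unfolding assms using lam_gt_1 by (simp add: matrix_vector_mult_scaleR)
  then have IR: "IR *v t = (1 / lam) *\<^sub>R t" by (simp only: IR_MR)
  show "(toral_map M ^^ n) (torus_of t) = torus_of (lam ^ n *\<^sub>R t)"
    by (induction n) (simp_all add: toral_map_torus_of matrix_vector_mult_scaleR assms mult.commute)
  show "(inv (toral_map M) ^^ n) (torus_of t) = torus_of ((1 / lam) ^ n *\<^sub>R t)"
    unfolding inv_toral_map
    by (induction n) (simp_all add: toral_map_torus_of matrix_vector_mult_scaleR IR mult.commute)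
qed

text \<open>Modulo integers the forward iterates are \<open>lam' ^ n\<close> times
  \<open>proj (ivec s) - ivec s\<close>; the backward iterates shrink along the eigenline
  itself.\<close>

lemma homoclinic_lift_proj: "homoclinic_lift M (proj (ivec s))"
proof -
  have "(\<lambda>n. (1 / lam) ^ n *\<^sub>R proj (ivec s)) \<longlonglongrightarrow> 0 *\<^sub>R proj (ivec s)"
    using lam_gt_1 by (intro tendsto_scaleR tendsto_const LIMSEQ_power_zero) simp
  then have "(\<lambda>n. torus_of ((1 / lam) ^ n *\<^sub>R proj (ivec s))) \<longlonglongrightarrow> torus_of 0"
    by (intro tendsto_torus_of) simp
  moreover have "(\<lambda>n. lam' ^ n *\<^sub>R (proj (ivec s) - ivec s)) \<longlonglongrightarrow> 0 *\<^sub>R (proj (ivec s) - ivec s)"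
    using abs_lam' by (intro tendsto_scaleR tendsto_const LIMSEQ_power_zero) simp
  then have "(\<lambda>n. torus_of (lam' ^ n *\<^sub>R (proj (ivec s) - ivec s))) \<longlonglongrightarrow> torus_of 0"
    by (intro tendsto_torus_of) simp
  then have "(\<lambda>n. torus_of (lam ^ n *\<^sub>R proj (ivec s))) \<longlonglongrightarrow> torus_of 0"
    unfolding power_lam_proj torus_of_add_ivec .
  ultimately show ?thesis
    unfolding homoclinic_lift_def homoclinic_def toral_map_pow_eigen[OF MR_proj]
    by (simp add: MR_proj)
qed

lemma proj_eigen:
  assumes "MR *v t = lam *\<^sub>R t"
  shows "proj t = t"
proof -
  have "proj t = (1 / sD) *\<^sub>R ((lam - lam') *\<^sub>R t)"
    by (simp only: proj_def assms scaleR_diff_left)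
  then show ?thesis using sD_pos by (simp add: lam_minus_lam')
qed

lemma proj_IR: "proj (IR *v z) = (1 / lam) *\<^sub>R proj z"
proof -
  have "proj z = lam *\<^sub>R proj (IR *v z)" by (metis proj_MR IR_MR(2))
  then show ?thesis using lam_gt_1 by simp
qed

text \<open>For large \<open>n\<close> write \<open>lam ^ n *\<^sub>R t = e n + ivec (s n)\<close> with \<open>e n\<close> small.  Then
  \<open>e (n + 1) - MR *v e n\<close> is a short lattice vector, so \<open>e\<close> is an orbit of \<open>MR\<close>, and it can only
  stay bounded if it lies on the contracted line.\<close>

lemma homoclinic_lift_imp_proj:
  assumes "homoclinic_lift M t"
  shows "\<exists>s. t = proj (ivec s)"
proof -
  have MRt: "MR *v t = lam *\<^sub>R t" and lim: "(\<lambda>n. torus_of (lam ^ n *\<^sub>R t)) \<longlonglongrightarrow> torus_of 0"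
    using assms toral_map_pow_eigen(1)[of t] unfolding homoclinic_lift_def homoclinic_def by auto
  obtain K where K: "0 < K" "\<And>x. norm (MR *v x) \<le> norm x * K"
    using bounded_linear.pos_bounded[OF matrix_vector_mul_bounded_linear] by blast
  obtain K' where K': "0 < K'" "\<And>x. norm (proj x) \<le> norm x * K'"
    using bounded_linear.pos_bounded[OF linear_conv_bounded_linear[THEN iffD1, OF linear_proj]] by blast
  \<comment> \<open>Chosen so that \<open>d * K + d < 1\<close>: the integer vector
    \<open>MR *v e n - e (Suc n)\<close> is then shorter than 1 and vanishes.\<close>
  define d where "d = 1 / (K + 2)"
  have d: "0 < d" "d * K + d < 1" using K(1) by (simp_all add: d_def field_simps)
  have "open (torus_of ` ball 0 d)" by (rule open_torus_of_image[OF open_ball])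
  moreover have "torus_of 0 \<in> torus_of ` ball 0 d" using d(1) by simp
  ultimately have "eventually (\<lambda>n. torus_of (lam ^ n *\<^sub>R t) \<in> torus_of ` ball 0 d) sequentially"
    using lim by (simp add: tendsto_def)
  then obtain m where m: "\<And>n. m \<le> n \<Longrightarrow> torus_of (lam ^ n *\<^sub>R t) \<in> torus_of ` ball 0 d"
    unfolding eventually_sequentially by blast
  have "\<exists>e s. norm e < d \<and> lam ^ (m + n) *\<^sub>R t = e + ivec s" for n
  proof -
    obtain e where e: "e \<in> ball 0 d" "torus_of (lam ^ (m + n) *\<^sub>R t) = torus_of e"
      using m[of "m + n"] by auto
    then show ?thesis unfolding torus_of_eq_iff_ivec by auto
  qed
  then obtain e s where es: "\<And>n. norm (e n) < d" "\<And>n. lam ^ (m + n) *\<^sub>R t = e n + ivec (s n)"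
    by metis
  have e_Suc: "e (Suc n) = MR *v e n" for n
  proof -
    have "e (Suc n) + ivec (s (Suc n)) = MR *v (lam ^ (m + n) *\<^sub>R t)"
      unfolding es(2)[symmetric] by (simp add: matrix_vector_mult_scaleR MRt mult.commute)
    also have "\<dots> = MR *v e n + ivec (act (s n))"
      unfolding es(2) by (simp only: matrix_vector_right_distrib MR_ivec)
    finally have "ivec (s (Suc n)) - ivec (act (s n)) = MR *v e n - e (Suc n)"
      by (simp add: algebra_simps)
    then have eq: "MR *v e n - e (Suc n) = ivec (fst (s (Suc n)) - fst (act (s n)), snd (s (Suc n)) - snd (act (s n)))"
      by (simp only: ivec_diff)
    have "norm (MR *v e n - e (Suc n)) \<le> norm (MR *v e n) + norm (e (Suc n))"
      by (rule norm_triangle_ineq4)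
    also have "\<dots> < d * K + d"
      using K es(1)[of n] es(1)[of "Suc n"] by (intro add_le_less_mono order_trans[OF K(2)] mult_right_mono) auto
    finally have "norm (MR *v e n - e (Suc n)) < 1" using d(2) by linarith
    from ivec_eq_0_if_small[OF this[unfolded eq]] have "MR *v e n - e (Suc n) = 0"
      unfolding eq by (simp add: vec_eq_iff forall_2)
    then show ?thesis by simp
  qed
  have "proj (e n) = lam ^ n *\<^sub>R proj (e 0)" for n
    by (induction n) (simp_all add: e_Suc proj_MR)
  then have bound: "lam ^ n * norm (proj (e 0)) \<le> d * K'" for n
    using order_trans[OF K'(2)[of "e n"]] es(1)[of n] K'(1) lam_gt_1
    by (metis abs_of_pos less_eq_real_def mult_right_mono norm_scaleR zero_less_power less_trans zero_less_one)
  have "proj (e 0) = 0"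
  proof (rule ccontr)
    assume "proj (e 0) \<noteq> 0"
    moreover obtain n where "d * K' / norm (proj (e 0)) < lam ^ n"
      using real_arch_pow[OF lam_gt_1] by blast
    ultimately show False using bound[of n] by (simp add: divide_less_eq)
  qed
  then have "lam ^ m *\<^sub>R t = proj (ivec (s 0))"
  proof -
    have "lam ^ m *\<^sub>R t = proj (lam ^ m *\<^sub>R t)"
      by (rule proj_eigen[symmetric]) (simp add: matrix_vector_mult_scaleR MRt mult.commute)
    also have "lam ^ m *\<^sub>R t = e 0 + ivec (s 0)" using es(2)[of 0] by simp
    also have "proj (e 0 + ivec (s 0)) = proj (ivec (s 0))"
      using \<open>proj (e 0) = 0\<close> by (simp add: linear_add[OF linear_proj])
    finally show ?thesis using es(2)[of 0] by simp
  qed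
  \<comment> \<open>Division by \<open>lam ^ m\<close> stays within projections of integer vectors
    because the inverse matrix is integral.\<close>
  moreover have "(1 / lam) ^ k *\<^sub>R proj (ivec s) = proj (ivec ((iact ^^ k) s))" for k s
  proof (induction k)
    case (Suc k)
    have "(1 / lam) ^ Suc k *\<^sub>R proj (ivec s) = (1 / lam) *\<^sub>R ((1 / lam) ^ k *\<^sub>R proj (ivec s))"
      by simp
    also have "\<dots> = proj (IR *v ivec ((iact ^^ k) s))" unfolding Suc proj_IR ..
    finally show ?case by (simp add: IR_ivec)
  qed simp
  moreover have "t = (1 / lam) ^ m *\<^sub>R lam ^ m *\<^sub>R t"
    using lam_gt_1 by (simp flip: power_mult_distrib)
  ultimately have "t = proj (ivec ((iact ^^ m) (s 0)))" by simp
  then show ?thesis by blast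
qed

lemma homoclinic_lift_iff: "homoclinic_lift M t \<longleftrightarrow> (\<exists>s. t = proj (ivec s))"
  using homoclinic_lift_imp_proj homoclinic_lift_proj by blast

lemma digit_sum_single: "digit_sum \<rho> (\<lambda>i. if i = k then 1 else 0) = \<rho> ^ k"
proof -
  have "(\<lambda>i. of_int (if i = k then 1 else 0) * \<rho> ^ i) = (\<lambda>i. if i = k then \<rho> ^ i else 0)" by auto
  then show ?thesis
    unfolding digit_sum_def using sums_single[of k "\<lambda>i. \<rho> ^ i"] by (simp add: sums_iff)
qed

lemma glue_single_in_two_sided: "glue (\<lambda>i. if i = k then 1 else 0) (\<lambda>_. 0) \<in> two_sided (trace M) (det M)"
  using \<sigma>_cases
proof
  assume "det M = 1"
  moreover have "no_max_prefix (trace M) (\<lambda>_. 0)"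
    using r_ge_3[OF \<open>det M = 1\<close>] by (simp add: no_max_prefix_def)
  ultimately show ?thesis
    using r_ge_3 by (auto simp: two_sided_pos_iff pos_seqs_def)
next
  assume "det M = - 1"
  then show ?thesis
    using r_pos by (auto simp: two_sided_neg_iff neg_right_def neg_left_def)
qed

text \<open>A sequence with a single 1 at place \<open>k + 1\<close> is mapped to
  \<open>1 / lam ^ (k + 1)\<close> times the homoclinic lift. Equal codings make these multiples of
  the difference of the lifts integral for all k; they tend to 0, so some of them vanish.\<close>

lemma coding_proj_inj:
  assumes "coding M (proj (ivec s)) = coding M (proj (ivec s'))"
  shows "s = s'"
proof -
  let ?q = "\<lambda>k. (1 / lam) ^ k / lam" and ?\<delta> = "proj (ivec s) - proj (ivec s')"
  have "torus_of (?q k *\<^sub>R proj (ivec s)) = torus_of (?q k *\<^sub>R proj (ivec s'))" for k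
  proof -
    let ?\<epsilon> = "glue (\<lambda>i. if i = k then 1 else 0) (\<lambda>_. 0)"
    have \<epsilon>: "?\<epsilon> \<in> symb_compactum M"
      unfolding symb_compactum_eq by (rule glue_single_in_two_sided)
    have "fut ?\<epsilon> = ?q k" "past ?\<epsilon> = 0"
      unfolding fut_def past_def glue_simps digit_sum_single by (simp_all add: digit_sum_def)
    then show ?thesis using fun_cong[OF assms, of ?\<epsilon>] by (simp add: coding_proj[OF \<epsilon>] param_def)
  qed
  then have lattice: "\<exists>l. ?q k *\<^sub>R ?\<delta> = ivec l" for k
    unfolding torus_of_eq_iff_ivec by (metis add_diff_cancel_left' scaleR_diff_right)
  have "(\<lambda>k. ?q k *\<^sub>R ?\<delta>) \<longlonglongrightarrow> (0 / lam) *\<^sub>R ?\<delta>"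
    using lam_gt_1 by (intro tendsto_scaleR tendsto_divide tendsto_const LIMSEQ_power_zero) auto
  then have "(\<lambda>k. ?q k *\<^sub>R ?\<delta>) \<longlonglongrightarrow> 0" by simp
  then obtain k where "norm (?q k *\<^sub>R ?\<delta>) < 1"
    using LIMSEQ_D[of _ 0 1] by (metis diff_zero order_refl zero_less_one)
  then have "?q k *\<^sub>R ?\<delta> = 0"
    using lattice[of k] ivec_eq_0_if_small by (fastforce simp: vec_eq_iff forall_2)
  then have "?\<delta> = 0" using lam_gt_1 by simp
  then show ?thesis by (simp add: proj_ivec_inj)
qed

end

section \<open>Minimal codings\<close>

context hyperbolic_toral_automorphism
begin

text \<open>The integer vector \<open>(n, k)\<close> from the definition of
  \<open>homoclinic_vec M u (- v)\<close>.\<close>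

definition hvec_lattice :: "int \<times> int \<Rightarrow> int \<times> int" where
  "hvec_lattice uv = (- det M * fst (act (- snd uv, fst uv)), - det M * snd (act (- snd uv, fst uv)))"

lemma det_squared: "det M * det M = 1"
  using \<sigma>_cases by auto

text \<open>With \<open>x = (- v, u)\<close> and w equal to \<open>- det M\<close> times the image
  of x, Cayley-Hamilton and \<open>det M * det M = 1\<close> show that the image of w minus the
  trace times w is x. Hence the numerator \<open>x + lam w\<close> is the image of w minus
  \<open>lam' w\<close>, as in \<open>proj\<close>.\<close>

lemma homoclinic_vec_eq_proj: "homoclinic_vec M u (- v) = proj (ivec (hvec_lattice (u, v)))"
proof -
  let ?x = "ivec (- v, u)" and ?w = "ivec (hvec_lattice (u, v))"
  have det2: "(of_int (det M) :: real) * of_int (det M) = 1"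
    using det_squared by (metis of_int_1 of_int_mult)
  have w: "?w = (- of_int (det M)) *\<^sub>R (MR *v ?x)"
    unfolding MR_ivec by (simp add: hvec_lattice_def vec_eq_iff forall_2)
  have "MR *v ?w - of_int (trace M) *\<^sub>R ?w = ?x"
    unfolding w matrix_vector_mult_scaleR Cayley_Hamilton
    by (simp add: algebra_simps det2)
  then have "MR *v ?w - lam' *\<^sub>R ?w = ?x + lam *\<^sub>R ?w"
    by (simp add: lam'_alt algebra_simps)
  moreover have "homoclinic_vec M u (- v) = (1 / sD) *\<^sub>R (?x + lam *\<^sub>R ?w)"
  proof -
    have "(M *v vector [- v, u]) $ 1 = fst (act (- v, u))" "(M *v vector [- v, u]) $ 2 = snd (act (- v, u))"
      by (simp_all add: matrix_vector_mult_def sum_2 act_def)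
    then show ?thesis
      unfolding homoclinic_vec_def Let_def
      by (simp add: vec_eq_iff forall_2 hvec_lattice_def mult.commute)
  qed
  ultimately show ?thesis by (simp add: proj_def)
qed

lemma bij_hvec_lattice: "bij hvec_lattice"
proof (rule bijI)
  show "inj hvec_lattice"
  proof (rule injI)
    fix x y assume "hvec_lattice x = hvec_lattice y"
    moreover have "det M \<noteq> 0" using \<sigma>_cases by auto
    ultimately have "act (- snd x, fst x) = act (- snd y, fst y)"
      by (simp add: hvec_lattice_def prod_eq_iff)
    then show "x = y" using iact_act by (metis minus_minus prod.collapse prod.inject)
  qed
  show "surj hvec_lattice"
  proof (rule surjI)
    fix s
    let ?s = "iact (- det M * fst s, - det M * snd s)"
    show "hvec_lattice (snd ?s, - fst ?s) = s"
      using det_squared by (simp add: hvec_lattice_def act_iact flip: mult.assoc)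
  qed
qed

text \<open>Applying the matrix multiplies \<open>ldet\<close> by \<open>det M\<close>, and
  \<open>ldet (- v, u) = - assoc_form M u v\<close>. This quarter turn is the reason for the sign in
  \<open>homoclinic_vec M u (- v)\<close>.\<close>

lemma ldet_hvec_lattice: "\<bar>ldet (hvec_lattice (u, v))\<bar> = \<bar>assoc_form M u v\<bar>"
proof -
  have "ldet (hvec_lattice (u, v)) = (det M * det M) * ldet (act (- v, u))"
    by (simp add: hvec_lattice_def ldet_def act_def algebra_simps)
  also have "ldet (act (- v, u)) = - det M * assoc_form M u v"
    by (simp add: ldet_def act_def assoc_form_def det_2 power2_eq_square algebra_simps)
  finally show ?thesis using \<sigma>_cases by (auto simp: abs_mult)
qed

lemma hvec_lattice_eq_0_iff: "hvec_lattice uv = (0, 0) \<longleftrightarrow> uv = (0, 0)"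
proof -
  have "hvec_lattice (0, 0) = (0, 0)" by (simp add: hvec_lattice_def act_def)
  then show ?thesis using bij_hvec_lattice by (metis bij_pointE)
qed

lemma arithmetic_coding_iff:
  "arithmetic_coding M \<phi> \<longleftrightarrow>
    (\<exists>uv. uv \<noteq> (0, 0) \<and> \<phi> = coding M (proj (ivec (hvec_lattice uv))))"
proof -
  have "arithmetic_coding M \<phi> \<longleftrightarrow> (\<exists>s. s \<noteq> (0, 0) \<and> \<phi> = coding M (proj (ivec s)))"
    unfolding arithmetic_coding_def homoclinic_lift_iff by (metis proj_ivec_eq_0_iff)
  also have "\<dots> \<longleftrightarrow> (\<exists>uv. uv \<noteq> (0, 0) \<and> \<phi> = coding M (proj (ivec (hvec_lattice uv))))"
    by (metis bij_hvec_lattice bij_pointE hvec_lattice_eq_0_iff)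
  finally show ?thesis .
qed

lemma to_one_ae_iff:
  assumes "(u, v) \<noteq> (0, 0)"
  shows "to_one_ae M (coding M (proj (ivec (hvec_lattice (u, v))))) K \<longleftrightarrow> K = nat \<bar>assoc_form M u v\<bar>"
proof -
  have "to_one_ae M (coding M (proj (ivec (hvec_lattice (u, v))))) (nat \<bar>assoc_form M u v\<bar>)"
    using to_one_ae_coding_proj[of "hvec_lattice (u, v)"] assms
    by (simp add: hvec_lattice_eq_0_iff ldet_hvec_lattice)
  then show ?thesis using to_one_ae_unique by blast
qed

lemma min_preimages_eq: "min_preimages M = integral_minimum (assoc_form M)"
proof -
  have "(\<exists>\<phi>. arithmetic_coding M \<phi> \<and> to_one_ae M \<phi> K) \<longleftrightarrow>
      (\<exists>u v. (u, v) \<noteq> (0, 0) \<and> K = nat \<bar>assoc_form M u v\<bar>)" for K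
    unfolding arithmetic_coding_iff using to_one_ae_iff by (metis surj_pair)
  then show ?thesis by (simp only: min_preimages_def integral_minimum_def)
qed

text \<open>The minimum is attained at a nonzero vector, where the form does not vanish. Positivity
  keeps \<open>(0, 0)\<close> out of the solutions of the minimal equation.\<close>

lemma min_preimages_pos: "0 < min_preimages M"
proof -
  have "\<exists>K u v. (u, v) \<noteq> (0, 0) \<and> K = nat \<bar>assoc_form M u v\<bar>" by (metis prod.inject zero_neq_one)
  then have "\<exists>u v. (u, v) \<noteq> (0, 0) \<and> min_preimages M = nat \<bar>assoc_form M u v\<bar>"
    unfolding min_preimages_eq integral_minimum_def by (rule LeastI_ex)
  then obtain u v where uv: "(u, v) \<noteq> (0, 0)" "min_preimages M = nat \<bar>assoc_form M u v\<bar>" by blast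
  have "ldet (hvec_lattice (u, v)) \<noteq> 0"
    using uv(1) by (simp add: ldet_eq_0_iff hvec_lattice_eq_0_iff)
  then show ?thesis using uv(2) ldet_hvec_lattice[of u v] by auto
qed

lemma minimal_coding_iff:
  "minimal_coding M \<phi> \<longleftrightarrow>
    (\<exists>u v. \<bar>assoc_form M u v\<bar> = int (min_preimages M) \<and> \<phi> = coding M (homoclinic_vec M u (- v)))"
proof -
  have "min_preimages M = nat \<bar>assoc_form M u v\<bar> \<longleftrightarrow> \<bar>assoc_form M u v\<bar> = int (min_preimages M)" for u v
    by auto
  moreover have "(u, v) \<noteq> (0, 0)" if "\<bar>assoc_form M u v\<bar> = int (min_preimages M)" for u v
    using that min_preimages_pos by (auto simp: assoc_form_def)
  ultimately show ?thesis
    unfolding minimal_coding_def arithmetic_coding_iff homoclinic_vec_eq_proj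
    using to_one_ae_iff by (metis surj_pair)
qed

lemma inj_coding_homoclinic_vec: "inj (\<lambda>(u, v). coding M (homoclinic_vec M u (- v)))"
proof (rule injI)
  fix x y :: "int \<times> int"
  assume "(\<lambda>(u, v). coding M (homoclinic_vec M u (- v))) x = (\<lambda>(u, v). coding M (homoclinic_vec M u (- v))) y"
  then have "coding M (proj (ivec (hvec_lattice x))) = coding M (proj (ivec (hvec_lattice y)))"
    by (simp add: split_def homoclinic_vec_eq_proj)
  then show "x = y" using coding_proj_inj bij_hvec_lattice by (meson bij_is_inj injD)
qed

end

text \<open>The natural parametrization is rendered as a bijection from the solutions onto the
  minimal codings; \<open>- v\<close> pairs each solution with the coding that has
  \<open>|assoc_form M u v|\<close> preimages.\<close>

theorem corollary3p2:
  fixes M :: "int^2^2"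
  assumes "invertible M" and "hyperbolic M" and "trace M > 0"
  shows "min_preimages M = integral_minimum (assoc_form M) \<and>
    bij_betw (\<lambda>(u, v). coding M (homoclinic_vec M u (- v)))
      {(u, v). assoc_form M u v = int (min_preimages M) \<or> assoc_form M u v = - int (min_preimages M)}
      {\<phi>. minimal_coding M \<phi>}"
proof -
  interpret hyperbolic_toral_automorphism M
    using assms by unfold_locales
  have eq: "(assoc_form M u v = int (min_preimages M) \<or> assoc_form M u v = - int (min_preimages M)) \<longleftrightarrow>
      \<bar>assoc_form M u v\<bar> = int (min_preimages M)" for u v
    by linarith
  show ?thesis
  proof (intro conjI bij_betw_imageI)
    show "min_preimages M = integral_minimum (assoc_form M)" by (rule min_preimages_eq)
    show "inj_on (\<lambda>(u, v). coding M (homoclinic_vec M u (- v)))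
      {(u, v). assoc_form M u v = int (min_preimages M) \<or> assoc_form M u v = - int (min_preimages M)}"
      using inj_coding_homoclinic_vec by (rule inj_on_subset) simp
    show "(\<lambda>(u, v). coding M (homoclinic_vec M u (- v))) `
      {(u, v). assoc_form M u v = int (min_preimages M) \<or> assoc_form M u v = - int (min_preimages M)} =
      {\<phi>. minimal_coding M \<phi>}"
      unfolding eq minimal_coding_iff by auto
  qed
qed

end
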